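(* Let $l\geq 2$ be a natural number. For $i=1,2,\ldots,l-1$ let $Q_i$ be a non-constant complex polynomial and let $P_i$ be a non-zero complex polynomial (possibly constant). Let $P_l$ be a non-constant complex polynomial. If, for all $i\neq j$ in $\{1,\ldots,l-1\}$, $\deg(Q_i)\neq\deg(Q_j)$ and none of the fundamental rays of $Q_i$ coincides with a fundamental ray of $Q_j$, then the entire function $$F_l(z)=P_1(z)\exp(Q_1(z))+P_2(z)\exp(Q_2(z))+\cdots+P_{l-1}(z)\exp(Q_{l-1}(z))+P_l(z)$$ has Baker omitted value (at $\infty$).
   Context: Fundamental rays: $\operatorname{Arg}$ denotes the argument of a non-zero complex number, taken modulo $2\pi$. For a polynomial $Q$ of degree $m\ge 1$, let $\beta_m$ be the argument of its leading coefficient, and put $\alpha_0(Q)=-\frac{\beta_m}{m}-\frac{\pi}{2m}$ and $\alpha_j(Q)=\alpha_0(Q)+\frac{\pi j}{m}$ for $j=1,2,\ldots,2m-1$. For $j=0,1,\ldots,2m-1$, the ray $R_{\alpha_j(Q)}=\{z:\operatorname{Arg}(z)=\alpha_j(Q)\}$ is called a fundamental ray of $Q$. Baker omitted value: A point $a\in\widehat{\mathbb C}$ is an omitted value of an entire function $f:\mathbb C\to\mathbb C$ if $f(z)\neq a$ for every $z\in\mathbb C$; the point $\infty$ is always an omitted value of a transcendental entire function. An omitted value $a\in\widehat{\mathbb C}$ of an entire function $f$ is called a Baker omitted value (bov) of $f$ if there is a disk $D$ (in the spherical metric) centered at $a$ such that $f^{-1}(D)\subset\mathbb C$ is infinitely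 connected (i.e. it is a domain, in particular connected, of infinite connectivity) and each connected component of the boundary of $f^{-1}(D)$ (boundary taken in $\mathbb C$) is bounded. Saying that an entire function "has bov" means that $\infty$ is a Baker omitted value of it. *)

theory Defs
  imports "HOL-Complex_Analysis.Complex_Analysis"
    "HOL-Computational_Algebra.Polynomial"
begin

text \<open>The Riemann sphere is the one-point compactification of the complex plane:
  \<open>Some z\<close> is the finite point \<open>z\<close> and \<open>None\<close> is the point at infinity.\<close>

type_synonym csphere = "complex option"

abbreviation riemann_sphere :: "csphere topology" where
  "riemann_sphere \<equiv> Alexandroff_compactification euclidean"

fun chordal_dist :: "csphere \<Rightarrow> csphere \<Rightarrow> real" where
  "chordal_dist (Some z) (Some w) =
     2 * cmod (z - w) / (sqrt (1 + (cmod z)\<^sup>2) * sqrt (1 + (cmod w)\<^sup>2))"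
| "chordal_dist (Some z) None = 2 / sqrt (1 + (cmod z)\<^sup>2)"
| "chordal_dist None (Some w) = 2 / sqrt (1 + (cmod w)\<^sup>2)"
| "chordal_dist None None = 0"

text \<open>The great-circle distance on the unit sphere under stereographic projection;
  it takes values in \<open>[0, \<pi>]\<close>.\<close>

definition spherical_dist :: "csphere \<Rightarrow> csphere \<Rightarrow> real" where
  "spherical_dist a b = 2 * arcsin (chordal_dist a b / 2)"

definition spherical_disk :: "csphere \<Rightarrow> real \<Rightarrow> csphere set" where
  "spherical_disk a r = {b. spherical_dist a b < r}"

definition connectivity_infinite :: "complex set \<Rightarrow> bool" where
  "connectivity_infinite U \<longleftrightarrow>
     infinite (connected_components_of (subtopology riemann_sphere (- (Some ` U))))"

definition infinitely_connected :: "complex set \<Rightarrow> bool" where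
  "infinitely_connected U \<longleftrightarrow>
     open U \<and> connected U \<and> U \<noteq> {} \<and> connectivity_infinite U"

definition omitted_value :: "(complex \<Rightarrow> complex) \<Rightarrow> csphere \<Rightarrow> bool" where
  "omitted_value f a \<longleftrightarrow> (\<forall>z. Some (f z) \<noteq> a)"

text \<open>The bound \<open>r < \<pi>\<close> keeps the disk a genuine one: a ball of radius \<open>\<pi>\<close> is the sphere
  without the antipode of its centre (about infinity, the sphere without \<open>0\<close>), and a ball of
  larger radius is the whole sphere.\<close>

definition baker_omitted_value :: "(complex \<Rightarrow> complex) \<Rightarrow> csphere \<Rightarrow> bool" where
  "baker_omitted_value f a \<longleftrightarrow>
     f holomorphic_on UNIV \<and> omitted_value f a \<and>
     (\<exists>r. 0 < r \<and> r < pi \<and>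
        (let U = {z. Some (f z) \<in> spherical_disk a r} in
           infinitely_connected U \<and> (\<forall>C \<in> components (frontier U). bounded C)))"

definition ray :: "real \<Rightarrow> complex set" where
  "ray \<alpha> = {z. z \<noteq> 0 \<and> is_Arg z \<alpha>}"

text \<open>\<open>Arg\<close> is the principal argument; another choice of the argument of the leading
  coefficient only permutes the \<open>2 * degree Q\<close> rays.\<close>

definition fundamental_angle :: "complex poly \<Rightarrow> nat \<Rightarrow> real" where
  "fundamental_angle Q j =
     - Arg (lead_coeff Q) / degree Q - pi / (2 * degree Q) + pi * j / degree Q"

definition fundamental_rays :: "complex poly \<Rightarrow> complex set set" where
  "fundamental_rays Q = {ray (fundamental_angle Q j) | j. j < 2 * degree Q}"

end

theory Submission
  imports Defs "HOL-Computational_Algebra.Fundamental_Theorem_Algebra"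
begin

text \<open>Let \<open>F\<close> be the sum in question and \<open>U = {z. \<bar>F z\<bar> > 1}\<close>, the preimage of the disk of spherical radius
  \<open>\<pi> / 2\<close> about infinity. Everything rests on closed curves \<open>u \<mapsto> R(u) u\<close>, \<open>\<bar>u\<bar> = 1\<close>, that are star-shaped
  about the origin, arbitrarily far out, and contained in \<open>U\<close>.

  Such curves settle the topology (\<open>surrounded_superlevel\<close>). By the maximum principle every component of
  \<open>U\<close> is unbounded, so it crosses every curve that surrounds one of its points; as the curve is a connected
  part of \<open>U\<close>, there is only one component. A connected set that avoids \<open>U\<close> cannot cross a curve, so it is
  bounded; this applies to the components of the boundary, and it traps the components of the complement of
  \<open>U\<close>. If these were finitely many, \<open>{z. \<bar>F z\<bar> \<le> 1}\<close> would be bounded, \<open>F\<close> would have a limit or a pole at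
  infinity, and \<open>F\<close> would be a polynomial. It is not, because in a suitable direction its term with the
  exponent of largest degree outgrows every polynomial and all other terms.

  The curves are found direction by direction (\<open>exp_poly_sum\<close>; the polynomial summand is treated as a term
  with exponent \<open>0\<close>). In a direction \<open>u\<close> growth or decay of the \<open>i\<close>-th exponential term is governed by the sign of
  \<open>Re (c\<^sub>i u ^ d\<^sub>i)\<close>, where \<open>d\<^sub>i\<close> and \<open>c\<^sub>i\<close> are the degree and the leading coefficient of its exponent. As long
  as none of these numbers vanishes, one term dominates all others because the degrees are distinct, and
  \<open>F\<close> tends to infinity near \<open>u\<close>: every large radius is suitable. The numbers vanish exactly on the
  fundamental rays. These are finitely many and, by hypothesis, at each of them only one term \<open>j\<close> is critical.
  If no other term dominates it, then \<open>F \<approx> T\<^sub>k (1 + T\<^sub>j / T\<^sub>k)\<close> where \<open>T\<^sub>k\<close> tends to infinity and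
  \<open>T\<^sub>j / T\<^sub>k = (A / B) exp g\<close> with \<open>A\<close>, \<open>B\<close>, \<open>g\<close> polynomials and \<open>g\<close> of degree \<open>d\<^sub>j\<close>. Along a circular arc about the
  origin that crosses the ray, \<open>g\<close> moves almost parallel to the real axis. So if \<open>(A / B) exp g\<close> is close to
  \<open>1\<close> at one point of the arc, its modulus changes much faster than its argument, and it never comes near
  \<open>-1\<close> (\<open>one_plus_rational_exp_on_arcs\<close>). Points with \<open>(A / B) exp g \<approx> 1\<close> exist at arbitrarily large radii,
  since \<open>g\<close> takes any value that is close to its value at a point of the ray near that point. Hence
  arbitrarily large radii suit a neighbourhood of the ray, and a continuous radius function \<open>R\<close> interpolates
  between the radii chosen at the different rays and a large constant in between
  (\<open>continuous_radius_avoiding\<close>).\<close>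

section \<open>Approaching infinity in a direction\<close>

text \<open>The directions range over a neighbourhood of \<open>b\<close> and the moduli tend to infinity, independently of each
  other: limits along this filter are uniform in a sector around the ray through \<open>b\<close>. For \<open>\<bar>b\<bar> \<noteq> 1\<close> the
  filter is trivial.\<close>

definition toward :: "complex \<Rightarrow> complex filter" where
  "toward b = inf at_infinity (filtercomap sgn (nhds b))"

lemma filterlim_toward_iff:
  "filterlim f (toward b) G \<longleftrightarrow>
     filterlim f at_infinity G \<and> ((\<lambda>x. sgn (f x)) \<longlongrightarrow> b) G"
  by (simp add: toward_def filterlim_inf filterlim_filtercomap_iff o_def)

lemma filterlim_toward_at_infinity: "filterlim (\<lambda>z. z) at_infinity (toward b)"
  and tendsto_sgn_toward: "(sgn \<longlongrightarrow> b) (toward b)"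
  using filterlim_ident[of "toward b"] unfolding filterlim_toward_iff by (simp_all add: filterlim_ident)

lemma toward_le_at_infinity: "toward b \<le> at_infinity"
  by (simp add: toward_def)

lemma eventually_toward:
  "eventually S (toward b) \<longleftrightarrow>
     (\<exists>\<delta>>0. \<exists>N. \<forall>z. N \<le> norm z \<longrightarrow> dist (sgn z) b < \<delta> \<longrightarrow> S z)"
  (is "?L \<longleftrightarrow> ?R")
proof
  assume ?L
  then obtain A C where A: "eventually A at_infinity" and C: "eventually C (filtercomap sgn (nhds b))"
    and S: "\<And>z. A z \<Longrightarrow> C z \<Longrightarrow> S z"
    unfolding toward_def eventually_inf by blast
  from A obtain N where "\<And>z. N \<le> norm z \<Longrightarrow> A z" unfolding eventually_at_infinity by blast
  moreover from C obtain \<delta> where "\<delta> > 0" "\<And>z. dist (sgn z) b < \<delta> \<Longrightarrow> C z"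
    unfolding eventually_filtercomap eventually_nhds_metric by blast
  ultimately show ?R using S by blast
next
  assume ?R
  then obtain \<delta> N where *: "\<delta> > 0" "\<And>z. N \<le> norm z \<Longrightarrow> dist (sgn z) b < \<delta> \<Longrightarrow> S z" by blast
  have "eventually (\<lambda>z. N \<le> norm z) (toward b)"
    using toward_le_at_infinity
    by (rule filter_leD) (auto simp: eventually_at_infinity)
  moreover have "eventually (\<lambda>z. dist (sgn z) b < \<delta>) (toward b)"
    using tendstoD[OF tendsto_sgn_toward \<open>\<delta> > 0\<close>] .
  ultimately show ?L by eventually_elim (use * in blast)
qed

lemma ray_filterlim_toward:
  assumes "norm b = 1"
  shows "filterlim (\<lambda>t. of_real t * b) (toward b) at_top"
  unfolding filterlim_toward_iff
proof
  have "filterlim (\<lambda>t. norm (of_real t * b)) at_top at_top"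
    using assms by (simp add: norm_mult filterlim_abs_real filterlim_ident)
  then show "filterlim (\<lambda>t. of_real t * b) at_infinity at_top"
    by (simp add: filterlim_at_infinity_conv_norm_at_top)
  have "eventually (\<lambda>t. sgn (of_real t * b) = b) at_top"
    using eventually_gt_at_top[of 0]
    by eventually_elim (use assms in \<open>simp add: sgn_div_norm norm_mult scaleR_conv_of_real\<close>)
  then show "((\<lambda>t. sgn (of_real t * b)) \<longlongrightarrow> b) at_top"
    by (rule tendsto_eventually)
qed

lemma toward_neq_bot: "norm b = 1 \<Longrightarrow> toward b \<noteq> bot"
  using ray_filterlim_toward[of b] by (auto simp: filterlim_def bot_unique filtermap_bot_iff)

lemma eventually_norm_ge_toward: "eventually (\<lambda>z. N \<le> norm z) (toward b)"
  using toward_le_at_infinity by (rule filter_leD) (auto simp: eventually_at_infinity)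

lemma poly_over_norm_power_toward:
  "((\<lambda>z. poly q z / of_real (norm z) ^ degree q) \<longlongrightarrow> lead_coeff q * b ^ degree q) (toward b)"
proof -
  have "((\<lambda>z. poly q z / z ^ degree q * sgn z ^ degree q) \<longlongrightarrow> lead_coeff q * b ^ degree q) (toward b)"
    by (intro tendsto_intros tendsto_sgn_toward tendsto_mono[OF toward_le_at_infinity poly_divide_tendsto_aux])
  moreover have "eventually (\<lambda>z. poly q z / z ^ degree q * sgn z ^ degree q
                   = poly q z / of_real (norm z) ^ degree q) (toward b)"
    using eventually_norm_ge_toward[of 1]
    by eventually_elim (auto simp: sgn_eq power_divide)
  ultimately show ?thesis by (rule Lim_transform_eventually)
qed

lemma Re_poly_over_norm_power_toward:
  "((\<lambda>z. Re (poly q z) / norm z ^ degree q) \<longlongrightarrow> Re (lead_coeff q * b ^ degree q)) (toward b)"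
proof -
  have *: "Re (w / of_real x ^ n) = Re w / x ^ n" for w x n
    by (metis Re_divide_of_real of_real_power)
  show ?thesis
    using tendsto_Re[OF poly_over_norm_power_toward[of q b]] unfolding * .
qed

text \<open>The hypothesis makes \<open>Re (q z) \<le> - s \<bar>z\<bar>\<close> in a sector around \<open>b\<close>, for some \<open>s > 0\<close>, and real
  exponential decay beats any power.\<close>

lemma power_exp_poly_tendsto_0:
  fixes q :: "complex poly"
  assumes d: "degree q > 0" and neg: "Re (lead_coeff q * b ^ degree q) < 0"
  shows "((\<lambda>z. z ^ n * exp (poly q z)) \<longlongrightarrow> 0) (toward b)"
proof -
  define s where "s = - Re (lead_coeff q * b ^ degree q) / 2"
  have s: "s > 0" using neg by (simp add: s_def)
  have "eventually (\<lambda>z. Re (poly q z) / norm z ^ degree q < - s) (toward b)"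
  proof (rule order_tendstoD(2)[OF Re_poly_over_norm_power_toward])
    show "Re (lead_coeff q * b ^ degree q) < - s" unfolding s_def using neg by linarith
  qed
  then have bd: "eventually (\<lambda>z. norm (z ^ n * exp (poly q z)) \<le> norm z ^ n * exp (- (s * norm z))) (toward b)"
    using eventually_norm_ge_toward[of 1]
  proof eventually_elim
    case (elim z)
    then have "0 < norm z ^ degree q" by (intro zero_less_power) linarith
    with elim have "Re (poly q z) \<le> - s * norm z ^ degree q"
      by (simp add: pos_divide_less_eq)
    also have "\<dots> \<le> - s * norm z ^ 1"
      using elim s d by (intro mult_left_mono_neg power_increasing) auto
    finally show ?case by (simp add: norm_mult norm_power mult_left_mono)
  qed
  have "((\<lambda>x. x ^ n * exp (- (s * x))) \<longlongrightarrow> 0) at_top"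
  proof -
    have "((\<lambda>x. (1 / s ^ n) * ((s * x) ^ n / exp (s * x))) \<longlongrightarrow> (1 / s ^ n) * 0) at_top"
      by (intro tendsto_mult tendsto_const filterlim_compose[OF tendsto_power_div_exp_0]
           filterlim_tendsto_pos_mult_at_top[OF tendsto_const s] filterlim_ident)
    also have "(\<lambda>x. (1 / s ^ n) * ((s * x) ^ n / exp (s * x))) = (\<lambda>x. x ^ n * exp (- (s * x)))"
      using s by (auto simp: fun_eq_iff field_simps exp_minus)
    finally show ?thesis by simp
  qed
  then have "((\<lambda>z. norm z ^ n * exp (- (s * norm z))) \<longlongrightarrow> 0) (toward b)"
    by (rule filterlim_compose)
       (use filterlim_toward_at_infinity in \<open>simp add: filterlim_at_infinity_conv_norm_at_top\<close>)
  then show ?thesis by (rule Lim_null_comparison[OF bd])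
qed

lemma rational_exp_poly_tendsto_0:
  fixes A B q :: "complex poly"
  assumes d: "degree q > 0" and neg: "Re (lead_coeff q * b ^ degree q) < 0" and B: "B \<noteq> 0"
  shows "((\<lambda>z. poly A z / poly B z * exp (poly q z)) \<longlongrightarrow> 0) (toward b)"
proof -
  define n m where "n = degree A" "m = degree B"
  note * = tendsto_mono[OF toward_le_at_infinity poly_divide_tendsto_aux]
  have inv: "((\<lambda>z::complex. inverse z ^ m) \<longlongrightarrow> 0 ^ m) (toward b)"
    by (intro tendsto_power tendsto_mono[OF toward_le_at_infinity tendsto_inverse_0])
  have "((\<lambda>z. (poly A z / z ^ n) / (poly B z / z ^ m) * inverse z ^ m * (z ^ n * exp (poly q z)))
          \<longlongrightarrow> lead_coeff A / lead_coeff B * 0 ^ m * 0) (toward b)"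
    unfolding n_m_def
    by (intro tendsto_mult tendsto_divide * inv[unfolded n_m_def] power_exp_poly_tendsto_0 d neg)
       (use B in auto)
  moreover have "eventually (\<lambda>z. (poly A z / z ^ n) / (poly B z / z ^ m) * inverse z ^ m * (z ^ n * exp (poly q z))
                   = poly A z / poly B z * exp (poly q z)) (toward b)"
    using eventually_norm_ge_toward[of 1]
    by eventually_elim (auto simp: power_inverse field_simps)
  ultimately show ?thesis by (auto dest: Lim_transform_eventually)
qed

lemma eventually_poly_nonzero_at_infinity:
  fixes p :: "complex poly"
  assumes "p \<noteq> 0"
  shows "eventually (\<lambda>z. poly p z \<noteq> 0) at_infinity"
proof -
  have "bounded {z. poly p z = 0}" using poly_roots_finite[OF assms] by (rule finite_imp_bounded)
  then obtain c where "\<forall>z. poly p z = 0 \<longrightarrow> norm z \<le> c" unfolding bounded_iff by auto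
  then show ?thesis unfolding eventually_at_infinity by (intro exI[of _ "c + 1"]) force
qed

section \<open>Circular arcs across a critical direction\<close>

text \<open>The modulus of a polynomial at \<open>x\<close> is that of the leading coefficient times the product of the distances
  to the roots, so the root nearest to \<open>x\<close> qualifies. Applied to \<open>g - v\<close> this is a quantitative open mapping
  theorem: \<open>g\<close> takes the value \<open>v\<close> close to \<open>x\<close> if \<open>g x\<close> is close to \<open>v\<close>.\<close>

lemma poly_root_near:
  fixes p :: "complex poly"
  assumes "degree p = Suc n"
  shows "\<exists>z. poly p z = 0 \<and> norm (lead_coeff p) * norm (x - z) ^ Suc n \<le> norm (poly p x)"
  using assms
proof (induction n arbitrary: p)
  case (0 p)
  then have "\<not> constant (poly p)" by (simp add: constant_degree)
  then obtain a where a: "poly p a = 0" using fundamental_theorem_of_algebra by blast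
  then obtain q where p: "p = [:- a, 1:] * q" using poly_eq_0_iff_dvd by blast
  have "q \<noteq> 0" using 0 p by auto
  then have "degree p = Suc (degree q)" unfolding p by (subst degree_mult_eq) auto
  then have "degree q = 0" using 0 by simp
  then obtain c where "q = [:c:]" by (rule degree_eq_zeroE)
  then have "norm (lead_coeff p) * norm (x - a) ^ Suc 0 \<le> norm (poly p x)"
    by (simp add: p norm_mult lead_coeff_mult del: mult_pCons_left mult_pCons_right)
  with a show ?case by blast
next
  case (Suc n p)
  then have "\<not> constant (poly p)" by (simp add: constant_degree)
  then obtain a where a: "poly p a = 0" using fundamental_theorem_of_algebra by blast
  then obtain q where p: "p = [:- a, 1:] * q" using poly_eq_0_iff_dvd by blast
  have "q \<noteq> 0" using Suc p by auto
  then have "degree p = Suc (degree q)" unfolding p by (subst degree_mult_eq) auto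
  then have "degree q = Suc n" using Suc by simp
  from Suc.IH[OF this] obtain w where w: "poly q w = 0"
    "norm (lead_coeff q) * norm (x - w) ^ Suc n \<le> norm (poly q x)" by blast
  have lc: "lead_coeff p = lead_coeff q" unfolding p by (subst lead_coeff_mult) simp
  have px: "norm (poly p x) = norm (poly q x) * norm (x - a)"
    by (simp add: p norm_mult del: mult_pCons_left mult_pCons_right)
  define z where "z = (if norm (x - a) \<le> norm (x - w) then a else w)"
  have le: "norm (x - z) \<le> norm (x - a)" "norm (x - z) \<le> norm (x - w)" by (auto simp: z_def)
  have "poly p z = 0" using a w by (simp add: z_def p del: mult_pCons_left mult_pCons_right)
  moreover have "norm (lead_coeff p) * norm (x - z) ^ Suc (Suc n)
        = (norm (lead_coeff q) * norm (x - z) ^ Suc n) * norm (x - z)"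
    using lc by simp
  moreover have "\<dots> \<le> (norm (lead_coeff q) * norm (x - w) ^ Suc n) * norm (x - a)"
    by (intro mult_mono mult_left_mono power_mono le) auto
  moreover have "\<dots> \<le> norm (poly p x)" unfolding px by (intro mult_right_mono w) auto
  ultimately show ?case by (intro exI[of _ z]) linarith
qed

text \<open>Both values are asymptotic to the leading monomial.\<close>

lemma poly_ratio_tendsto_1:
  fixes A :: "complex poly"
  assumes A: "A \<noteq> 0" and f: "filterlim f at_infinity G" and g: "filterlim g at_infinity G"
    and fg: "((\<lambda>x. f x / g x) \<longlongrightarrow> 1) G"
  shows "((\<lambda>x. poly A (f x) / poly A (g x)) \<longlongrightarrow> 1) G"
proof -
  define n where "n = degree A"
  have *: "((\<lambda>z. poly A z / z ^ n) \<longlongrightarrow> lead_coeff A) at_infinity"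
    unfolding n_def by (rule poly_divide_tendsto_aux)
  have "((\<lambda>x. (poly A (f x) / f x ^ n) / (poly A (g x) / g x ^ n) * (f x / g x) ^ n)
     \<longlongrightarrow> lead_coeff A / lead_coeff A * 1 ^ n) G"
    using A by (intro tendsto_intros filterlim_compose[OF * f] filterlim_compose[OF * g] fg) auto
  moreover have "eventually (\<lambda>x. f x \<noteq> 0) G" "eventually (\<lambda>x. g x \<noteq> 0) G"
    using f g by (auto intro: filterlim_at_infinity_imp_eventually_ne)
  then have "eventually (\<lambda>x. (poly A (f x) / f x ^ n) / (poly A (g x) / g x ^ n) * (f x / g x) ^ n
      = poly A (f x) / poly A (g x)) G"
    by eventually_elim (auto simp: field_simps)
  ultimately show ?thesis using A by (auto dest: Lim_transform_eventually)
qed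

lemma rational_ratio_tendsto_1:
  fixes A B :: "complex poly"
  assumes "A \<noteq> 0" "B \<noteq> 0" and f: "filterlim f at_infinity G" and g: "filterlim g at_infinity G"
    and fg: "((\<lambda>x. f x / g x) \<longlongrightarrow> 1) G"
  shows "((\<lambda>x. (poly A (f x) / poly B (f x)) / (poly A (g x) / poly B (g x))) \<longlongrightarrow> 1) G"
  using tendsto_divide[OF poly_ratio_tendsto_1[OF assms(1) f g fg] poly_ratio_tendsto_1[OF assms(2) f g fg]]
  by (simp add: mult.commute)

lemma ln_norm_poly_over_power:
  fixes A :: "complex poly"
  assumes A: "A \<noteq> 0" and b: "norm b = 1" and d: "d > 0"
  shows "((\<lambda>t. ln (norm (poly A (of_real t * b))) / t ^ d) \<longlongrightarrow> 0) at_top"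
proof -
  define n where "n = degree A"
  have *: "((\<lambda>z. poly A z / z ^ n) \<longlongrightarrow> lead_coeff A) at_infinity"
    unfolding n_def by (rule poly_divide_tendsto_aux)
  have lim: "filterlim (\<lambda>t. of_real t * b) at_infinity at_top"
    using ray_filterlim_toward[OF b] by (simp add: filterlim_toward_iff)
  have inf: "filterlim (\<lambda>t::real. t ^ d) at_infinity at_top"
    using filterlim_pow_at_top[OF d filterlim_ident] by (rule filterlim_at_top_imp_at_infinity)
  have 1: "((\<lambda>t. ln (norm (poly A (of_real t * b) / (of_real t * b) ^ n)) / t ^ d) \<longlongrightarrow> 0) at_top"
  proof (rule tendsto_divide_0[OF _ inf])
    show "((\<lambda>t. ln (norm (poly A (of_real t * b) / (of_real t * b) ^ n)))
            \<longlongrightarrow> ln (norm (lead_coeff A))) at_top"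
      by (intro tendsto_ln tendsto_norm filterlim_compose[OF * lim]) (use A in auto)
  qed
  have 2: "((\<lambda>t::real. ln t / t ^ d) \<longlongrightarrow> 0) at_top"
  proof (rule Lim_null_comparison)
    show "((\<lambda>t. ln t / t) \<longlongrightarrow> (0::real)) at_top" by (rule ln_x_over_x_tendsto_0)
    show "eventually (\<lambda>t. norm (ln t / t ^ d) \<le> ln t / t) at_top"
      using eventually_ge_at_top[of 1]
    proof eventually_elim
      case (elim t)
      have "t ^ 1 \<le> t ^ d" using elim d by (intro power_increasing) auto
      then have "ln t / t ^ d \<le> ln t / t" using elim by (intro divide_left_mono) auto
      then show ?case using elim by simp
    qed
  qed
  have "((\<lambda>t. ln (norm (poly A (of_real t * b) / (of_real t * b) ^ n)) / t ^ d + real n * (ln t / t ^ d))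
     \<longlongrightarrow> 0 + real n * 0) at_top"
    by (intro tendsto_intros 1 2)
  moreover have "eventually (\<lambda>t. poly A (of_real t * b) \<noteq> 0) at_top"
    using eventually_poly_nonzero_at_infinity[OF A] lim by (rule eventually_compose_filterlim)
  then have "eventually (\<lambda>t. ln (norm (poly A (of_real t * b) / (of_real t * b) ^ n)) / t ^ d + real n * (ln t / t ^ d)
      = ln (norm (poly A (of_real t * b))) / t ^ d) at_top"
    using eventually_gt_at_top[of 0]
    by eventually_elim (simp add: norm_divide norm_mult norm_power b ln_div ln_realpow diff_divide_distrib)
  ultimately show ?thesis by (auto dest: Lim_transform_eventually)
qed

text \<open>Let \<open>d\<close> be the degree of \<open>g\<close>. At \<open>x = t b\<close> the real part of \<open>g\<close> is \<open>o(t ^ d)\<close>, as \<open>b\<close> is critical,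
  and so is the logarithm of \<open>A / B\<close>. The solutions \<open>v\<close> of \<open>exp v = B x / A x\<close> lie on a vertical line with spacing \<open>2 \<pi>\<close>, so one of
  them is at distance \<open>o(t ^ d)\<close> from \<open>g x\<close>. Therefore \<open>g\<close> takes the value \<open>v\<close> at some \<open>\<zeta>\<close> with \<open>\<bar>\<zeta> - x\<bar> = o(t)\<close>, and passing from \<open>x\<close> to \<open>\<zeta>\<close>
  changes \<open>A / B\<close> only by a factor that tends to \<open>1\<close>.\<close>

lemma rational_exp_poly_near_1_toward:
  fixes A B g :: "complex poly"
  assumes A: "A \<noteq> 0" and B: "B \<noteq> 0" and d: "degree g > 0" and b: "norm b = 1"
    and crit: "Re (lead_coeff g * b ^ degree g) = 0"
  obtains \<zeta> :: "real \<Rightarrow> complex" where "filterlim \<zeta> (toward b) at_top"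
    "((\<lambda>t. poly A (\<zeta> t) / poly B (\<zeta> t) * exp (poly g (\<zeta> t))) \<longlongrightarrow> 1) at_top"
proof -
  define d where "d = degree g"
  have d0: "d > 0" using d by (simp add: d_def)
  define x where "x t = of_real t * b" for t
  define r where "r z = poly A z / poly B z" for z
  \<comment> \<open>Any \<open>v\<close> with \<open>exp v = 1 / r (x t)\<close> serves; the multiple of \<open>2 \<pi> \<i>\<close> brings it close to \<open>g (x t)\<close>.\<close>
  define k where "k t = \<lfloor>Im (poly g (x t)) / (2 * pi)\<rfloor>" for t
  define v where "v t = - Ln (r (x t)) + (2 * of_int (k t) * pi) * \<i>" for t
  have "\<exists>z. poly g z = v t \<and> norm (lead_coeff g) * norm (x t - z) ^ d \<le> norm (poly g (x t) - v t)" for t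
  proof -
    obtain n where n: "d = Suc n" using d0 gr0_implies_Suc by blast
    have deg: "degree (g - [:v t:]) = d"
      unfolding diff_conv_add_uminus using d0 degree_add_eq_left[of "- [:v t:]" g] by (simp add: d_def)
    moreover have "lead_coeff (g - [:v t:]) = lead_coeff g"
      unfolding deg using n by (simp add: d_def)
    ultimately show ?thesis
      using poly_root_near[of "g - [:v t:]" n "x t"] n by simp
  qed
  then obtain \<zeta> where \<zeta>: "\<And>t. poly g (\<zeta> t) = v t"
    "\<And>t. norm (lead_coeff g) * norm (x t - \<zeta> t) ^ d \<le> norm (poly g (x t) - v t)" by metis
  have xlim: "filterlim x (toward b) at_top"
    unfolding x_def by (rule ray_filterlim_toward[OF b])
  then have xinf: "filterlim x at_infinity at_top" by (simp add: filterlim_toward_iff)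
  have rnz: "eventually (\<lambda>t. poly A (x t) \<noteq> 0) at_top" "eventually (\<lambda>t. poly B (x t) \<noteq> 0) at_top"
    using eventually_poly_nonzero_at_infinity[OF A] eventually_poly_nonzero_at_infinity[OF B] xinf
    by (auto elim: eventually_compose_filterlim)
  define e where "e t = \<bar>Re (poly g (x t)) / t ^ d\<bar> + \<bar>ln (norm (poly A (x t))) / t ^ d\<bar>
      + \<bar>ln (norm (poly B (x t))) / t ^ d\<bar> + 3 * pi / t ^ d" for t
  have bound: "eventually (\<lambda>t. norm (poly g (x t) - v t) / t ^ d \<le> e t) at_top"
    using rnz eventually_gt_at_top[of 0]
  proof eventually_elim
    case (elim t)
    have r0: "r (x t) \<noteq> 0" using elim by (simp add: r_def)
    let ?q = "Im (poly g (x t))"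
    have tri: "norm (of_real a + of_real c * \<i> + L) \<le> \<bar>a\<bar> + \<bar>c\<bar> + norm L" for a c L
      by (auto simp: norm_mult intro!: norm_triangle_le add_mono)
    have fl: "\<bar>?q - 2 * pi * of_int (k t)\<bar> \<le> 2 * pi"
    proof -
      have "of_int (k t) \<le> ?q / (2 * pi)" "?q / (2 * pi) \<le> of_int (k t) + 1"
        unfolding k_def by linarith+
      then have "2 * pi * of_int (k t) \<le> ?q" "?q \<le> 2 * pi * of_int (k t) + 2 * pi"
        by (auto simp: field_simps)
      then show ?thesis by linarith
    qed
    have "poly g (x t) - v t = of_real (Re (poly g (x t))) + of_real (?q - 2 * pi * of_int (k t)) * \<i> + Ln (r (x t))"
      unfolding v_def by (simp add: complex_eq_iff)
    then have "norm (poly g (x t) - v t) \<le> \<bar>Re (poly g (x t))\<bar> + \<bar>?q - 2 * pi * of_int (k t)\<bar> + norm (Ln (r (x t)))"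
      using tri by presburger
    also have "norm (Ln (r (x t))) \<le> \<bar>ln (norm (r (x t)))\<bar> + pi"
      using cmod_le[of "Ln (r (x t))"] mpi_less_Im_Ln[OF r0] Im_Ln_le_pi[OF r0] Re_Ln[OF r0] by auto
    also have "ln (norm (r (x t))) = ln (norm (poly A (x t))) - ln (norm (poly B (x t)))"
      using elim by (simp add: r_def norm_divide ln_div)
    finally have "norm (poly g (x t) - v t) \<le> \<bar>Re (poly g (x t))\<bar> + \<bar>ln (norm (poly A (x t)))\<bar>
        + \<bar>ln (norm (poly B (x t)))\<bar> + 3 * pi" using fl by linarith
    then have "norm (poly g (x t) - v t) / t ^ d \<le> (\<bar>Re (poly g (x t))\<bar> + \<bar>ln (norm (poly A (x t)))\<bar>
        + \<bar>ln (norm (poly B (x t)))\<bar> + 3 * pi) / t ^ d"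
      using elim by (intro divide_right_mono) auto
    also have "\<dots> = e t" using elim by (simp add: e_def add_divide_distrib abs_div)
    finally show ?case .
  qed
  have "((\<lambda>t. Re (poly g (x t)) / norm (x t) ^ d) \<longlongrightarrow> Re (lead_coeff g * b ^ d)) at_top"
    unfolding d_def by (rule filterlim_compose[OF Re_poly_over_norm_power_toward xlim])
  moreover have "eventually (\<lambda>t. Re (poly g (x t)) / norm (x t) ^ d = Re (poly g (x t)) / t ^ d) at_top"
    using eventually_gt_at_top[of 0] by eventually_elim (simp add: x_def norm_mult b)
  ultimately have "((\<lambda>t. Re (poly g (x t)) / t ^ d) \<longlongrightarrow> Re (lead_coeff g * b ^ d)) at_top"
    by (rule Lim_transform_eventually)
  then have re0: "((\<lambda>t. Re (poly g (x t)) / t ^ d) \<longlongrightarrow> 0) at_top"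
    using crit by (simp only: d_def)
  have pinf: "filterlim (\<lambda>t::real. t ^ d) at_infinity at_top"
    using filterlim_pow_at_top[OF d0 filterlim_ident] by (rule filterlim_at_top_imp_at_infinity)
  have e0: "(e \<longlongrightarrow> \<bar>0\<bar> + \<bar>0\<bar> + \<bar>0\<bar> + 0) at_top"
    unfolding e_def
    by (intro tendsto_intros re0 tendsto_divide_0[OF tendsto_const pinf]
         ln_norm_poly_over_power[OF A b d0, folded x_def] ln_norm_poly_over_power[OF B b d0, folded x_def])
  have c0: "norm (lead_coeff g) > 0" using d by auto
  have "((\<lambda>t. (norm (x t - \<zeta> t) / t) ^ d) \<longlongrightarrow> 0) at_top"
  proof (rule Lim_null_comparison)
    show "eventually (\<lambda>t. norm ((norm (x t - \<zeta> t) / t) ^ d) \<le> e t / norm (lead_coeff g)) at_top"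
      using bound eventually_gt_at_top[of 0]
    proof eventually_elim
      case (elim t)
      have "norm (x t - \<zeta> t) ^ d \<le> norm (poly g (x t) - v t) / norm (lead_coeff g)"
        using \<zeta>(2)[of t] c0 by (simp add: field_simps)
      then have "norm (x t - \<zeta> t) ^ d / t ^ d \<le> norm (poly g (x t) - v t) / norm (lead_coeff g) / t ^ d"
        using elim by (intro divide_right_mono) auto
      also have "\<dots> = norm (poly g (x t) - v t) / t ^ d / norm (lead_coeff g)" by simp
      also have "\<dots> \<le> e t / norm (lead_coeff g)" using elim by (intro divide_right_mono) auto
      finally show ?case using elim by (simp add: power_divide)
    qed
    show "((\<lambda>t. e t / norm (lead_coeff g)) \<longlongrightarrow> 0) at_top"
      using tendsto_divide[OF e0 tendsto_const[of "norm (lead_coeff g)"]] c0 by simp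
  qed
  then have "((\<lambda>t. root d ((norm (x t - \<zeta> t) / t) ^ d)) \<longlongrightarrow> root d 0) at_top"
    by (rule tendsto_real_root)
  moreover have "eventually (\<lambda>t. root d ((norm (x t - \<zeta> t) / t) ^ d) = norm ((x t - \<zeta> t) / of_real t)) at_top"
    using eventually_gt_at_top[of 0]
    by eventually_elim (use d0 in \<open>simp add: real_root_power_cancel norm_divide\<close>)
  ultimately have "((\<lambda>t. norm ((x t - \<zeta> t) / of_real t)) \<longlongrightarrow> 0) at_top"
    by (auto dest: Lim_transform_eventually)
  then have "((\<lambda>t. (x t - \<zeta> t) / of_real t) \<longlongrightarrow> 0) at_top" by (rule tendsto_norm_zero_cancel)
  then have "((\<lambda>t. b - (x t - \<zeta> t) / of_real t) \<longlongrightarrow> b - 0) at_top" by (intro tendsto_intros)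
  moreover have "eventually (\<lambda>t. b - (x t - \<zeta> t) / of_real t = \<zeta> t / of_real t) at_top"
    using eventually_gt_at_top[of 0]
    by eventually_elim (simp add: x_def field_simps)
  ultimately have zt: "((\<lambda>t. \<zeta> t / of_real t) \<longlongrightarrow> b) at_top"
    by (auto dest: Lim_transform_eventually)
  have b0: "b \<noteq> 0" using b by auto
  have zinf: "filterlim \<zeta> at_infinity at_top"
  proof -
    have "filterlim (\<lambda>t. norm (\<zeta> t / of_real t) * t) at_top at_top"
      using filterlim_tendsto_pos_mult_at_top[OF tendsto_norm[OF zt] _ filterlim_ident] b by simp
    moreover have "eventually (\<lambda>t. norm (\<zeta> t / of_real t) * t = norm (\<zeta> t)) at_top"
      using eventually_gt_at_top[of 0] by eventually_elim (simp add: norm_divide)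
    ultimately have "filterlim (\<lambda>t. norm (\<zeta> t)) at_top at_top"
      using filterlim_cong[OF refl refl] by fastforce
    then show ?thesis by (simp add: filterlim_at_infinity_conv_norm_at_top)
  qed
  have zsgn: "((\<lambda>t. sgn (\<zeta> t)) \<longlongrightarrow> b) at_top"
  proof -
    have "((\<lambda>t. sgn (\<zeta> t / of_real t)) \<longlongrightarrow> sgn b) at_top" by (rule tendsto_sgn[OF zt b0])
    moreover have "eventually (\<lambda>t. sgn (\<zeta> t / of_real t) = sgn (\<zeta> t)) at_top"
      using eventually_gt_at_top[of 0] by eventually_elim (simp add: sgn_divide sgn_of_real)
    moreover have "sgn b = b" using b by (simp add: sgn_div_norm)
    ultimately show ?thesis by (auto dest: Lim_transform_eventually)
  qed
  have zx: "((\<lambda>t. \<zeta> t / x t) \<longlongrightarrow> 1) at_top"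
  proof -
    have "((\<lambda>t. \<zeta> t / of_real t / b) \<longlongrightarrow> b / b) at_top" by (intro tendsto_intros zt b0)
    then show ?thesis using b0 by (simp add: x_def)
  qed
  have "((\<lambda>t. r (\<zeta> t) / r (x t)) \<longlongrightarrow> 1) at_top"
    unfolding r_def by (rule rational_ratio_tendsto_1[OF A B zinf xinf zx])
  moreover have "eventually (\<lambda>t. r (\<zeta> t) / r (x t) = r (\<zeta> t) * exp (poly g (\<zeta> t))) at_top"
    using rnz
  proof eventually_elim
    case (elim t)
    have "exp (v t) = inverse (r (x t))"
      unfolding v_def exp_add using elim exp_integer_2pi[of "of_int (k t)"]
      by (simp add: exp_minus r_def)
    then show ?case by (simp add: \<zeta>(1) divide_inverse)
  qed
  ultimately have "((\<lambda>t. r (\<zeta> t) * exp (poly g (\<zeta> t))) \<longlongrightarrow> 1) at_top"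
    by (rule Lim_transform_eventually)
  with zinf zsgn show ?thesis
    using that[of \<zeta>] by (simp add: filterlim_toward_iff r_def)
qed

lemma sgn_of_real_mult_unit:
  fixes u :: complex
  shows "0 < \<rho> \<Longrightarrow> norm u = 1 \<Longrightarrow> sgn (of_real \<rho> * u) = u"
  by (simp add: sgn_div_norm norm_mult scaleR_conv_of_real field_simps)

text \<open>If \<open>Re x\<close> is large in modulus, then \<open>\<kappa> exp x\<close> has modulus far from \<open>1\<close>; otherwise \<open>Im x\<close> is small and
  \<open>\<kappa> exp x\<close> lies in the right half plane.\<close>

lemma norm_one_plus_exp_ge:
  fixes \<kappa> x :: complex
  assumes k: "norm (\<kappa> - 1) \<le> 1 / 5" and x: "\<bar>Im x\<bar> \<le> \<bar>Re x\<bar> / 4"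
  shows "norm (1 + \<kappa> * exp x) \<ge> 1 / 2"
proof -
  have kn: "norm \<kappa> \<ge> 4 / 5" "norm \<kappa> \<le> 6 / 5"
    using k norm_triangle_ineq3[of \<kappa> 1] by auto
  have n: "norm (\<kappa> * exp x) = norm \<kappa> * exp (Re x)" by (simp add: norm_mult)
  consider "Re x \<ge> 2" | "Re x \<le> -2" | "\<bar>Re x\<bar> \<le> 2" by linarith
  then show ?thesis
  proof cases
    case 1
    then have "exp (Re x) \<ge> 3" using exp_ge_add_one_self[of "Re x"] by linarith
    then have "4 / 5 * 3 \<le> norm \<kappa> * exp (Re x)" using kn by (intro mult_mono) auto
    moreover have "norm (\<kappa> * exp x) - norm (1::complex) \<le> norm (\<kappa> * exp x + 1)" by (rule norm_diff_ineq)
    ultimately show ?thesis using n by (simp add: add.commute)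
  next
    case 2
    then have "exp (- Re x) \<ge> 3" using exp_ge_add_one_self[of "- Re x"] by linarith
    then have "exp (Re x) \<le> 1 / 3" by (simp add: exp_minus field_simps)
    then have "norm \<kappa> * exp (Re x) \<le> 6 / 5 * (1 / 3)" using kn by (intro mult_mono) auto
    moreover have "norm (1::complex) - norm (\<kappa> * exp x) \<le> norm (1 + \<kappa> * exp x)" by (rule norm_diff_ineq)
    ultimately show ?thesis using n by simp
  next
    case 3
    then have y: "\<bar>Im x\<bar> \<le> 1 / 2" using x by linarith
    have "1 / 2 = cos (pi / 3)" by (simp add: cos_60)
    also have "\<dots> \<le> cos \<bar>Im x\<bar>"
      using y pi_gt3 by (intro cos_monotone_0_pi_le) auto
    finally have c: "cos (Im x) \<ge> 1 / 2" by simp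
    have "Re \<kappa> \<ge> 4 / 5" "\<bar>Im \<kappa>\<bar> \<le> 1 / 5"
      using k abs_Re_le_cmod[of "\<kappa> - 1"] abs_Im_le_cmod[of "\<kappa> - 1"] by (auto simp: abs_le_iff)
    then have "4 / 5 * (1 / 2) \<le> Re \<kappa> * cos (Im x)" "\<bar>Im \<kappa>\<bar> * \<bar>sin (Im x)\<bar> \<le> 1 / 5 * 1"
      using c by (intro mult_mono; simp)+
    moreover have "Im \<kappa> * sin (Im x) \<le> \<bar>Im \<kappa>\<bar> * \<bar>sin (Im x)\<bar>" by (metis abs_ge_self abs_mult)
    ultimately have "0 \<le> Re \<kappa> * cos (Im x) - Im \<kappa> * sin (Im x)" by linarith
    then have "0 \<le> exp (Re x) * (Re \<kappa> * cos (Im x) - Im \<kappa> * sin (Im x))" by simp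
    also have "\<dots> = Re (\<kappa> * exp x)" by (simp add: Re_exp Im_exp algebra_simps)
    finally have "1 \<le> Re (1 + \<kappa> * exp x)" by simp
    also have "\<dots> \<le> norm (1 + \<kappa> * exp x)" by (rule complex_Re_le_cmod)
    finally show ?thesis by simp
  qed
qed

text \<open>Factoring \<open>sgn z - sgn w\<close> out of the difference of each monomial leaves a sum that converges when \<open>z\<close>
  and \<open>w\<close> tend to infinity in a common direction; only its top term \<open>m = degree g\<close> survives.\<close>

lemma poly_diff_on_circle:
  fixes g :: "complex poly" and z w :: complex
  assumes nz: "norm z = norm w" "z \<noteq> 0"
  shows "poly g z - poly g w = of_real (norm z) ^ degree g * ((sgn z - sgn w) *
    (\<Sum>m\<le>degree g. coeff g m * of_real (norm z ^ m / norm z ^ degree g) *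
       (\<Sum>i<m. sgn w ^ (m - Suc i) * sgn z ^ i)))"
proof -
  define t u v d where "t = (of_real (norm z) :: complex)" "u = sgn z" "v = sgn w" "d = degree g"
  have t: "t \<noteq> 0" using nz(2) by (simp add: t_u_v_d_def)
  have "w \<noteq> 0" using nz by (metis norm_eq_zero)
  then have z: "z = t * u" "w = t * v" using nz by (auto simp: t_u_v_d_def sgn_eq)
  have "poly g z - poly g w = (\<Sum>m\<le>d. coeff g m * (t ^ m * (u ^ m - v ^ m)))"
    unfolding poly_altdef z t_u_v_d_def(4)[symmetric] sum_subtractf[symmetric]
    by (intro sum.cong) (auto simp: power_mult_distrib algebra_simps)
  also have "\<dots> = (\<Sum>m\<le>d. t ^ d * ((u - v) * (coeff g m * (t ^ m / t ^ d) * (\<Sum>i<m. v ^ (m - Suc i) * u ^ i))))"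
    using t by (intro sum.cong refl) (simp add: power_diff_sumr2)
  also have "\<dots> = t ^ d * ((u - v) * (\<Sum>m\<le>d. coeff g m * (t ^ m / t ^ d) * (\<Sum>i<m. v ^ (m - Suc i) * u ^ i)))"
    by (simp add: sum_distrib_left)
  finally show ?thesis by (simp add: t_u_v_d_def)
qed

lemma power_over_power_norm_toward:
  assumes "m \<le> d"
  shows "((\<lambda>z::complex. norm z ^ m / norm z ^ d) \<longlongrightarrow> (if m = d then 1 else 0)) (toward b)"
proof -
  have "((\<lambda>z::complex. norm (inverse z ^ (d - m))) \<longlongrightarrow> norm ((0::complex) ^ (d - m))) (toward b)"
    by (intro tendsto_norm tendsto_power tendsto_mono[OF toward_le_at_infinity tendsto_inverse_0])
  moreover have "eventually (\<lambda>z::complex. norm (inverse z ^ (d - m)) = norm z ^ m / norm z ^ d) (toward b)"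
    using eventually_norm_ge_toward[of 1]
  proof eventually_elim
    case (elim z)
    then have "norm z \<noteq> 0" by auto
    moreover have "norm z ^ d = norm z ^ m * norm z ^ (d - m)"
      using assms by (simp flip: power_add)
    ultimately show ?case by (simp add: norm_power norm_inverse power_inverse divide_inverse)
  qed
  ultimately have "((\<lambda>z::complex. norm z ^ m / norm z ^ d) \<longlongrightarrow> norm ((0::complex) ^ (d - m))) (toward b)"
    by (rule Lim_transform_eventually)
  moreover have "norm ((0::complex) ^ (d - m)) = (if m = d then 1 else 0)" using assms by (auto simp: power_0_left)
  ultimately show ?thesis by simp
qed

text \<open>The chord between two points of the unit circle near \<open>b\<close> is almost perpendicular to \<open>b\<close>. The increment
  of \<open>g\<close> between \<open>z\<close> and \<open>w\<close> is therefore approximately a real multiple of \<open>\<i> c b ^ d\<close>, where \<open>d\<close> and \<open>c\<close>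
  are the degree and leading coefficient of \<open>g\<close>; and \<open>c b ^ d\<close> is imaginary.\<close>

lemma poly_phase_variation_small:
  fixes g :: "complex poly"
  assumes d: "degree g > 0" and b: "norm b = 1"
    and crit: "Re (lead_coeff g * b ^ degree g) = 0"
  shows "eventually (\<lambda>(z, w). norm z = norm w \<longrightarrow>
           \<bar>Im (poly g z - poly g w)\<bar> \<le> \<bar>Re (poly g z - poly g w)\<bar> / 4) (toward b \<times>\<^sub>F toward b)"
proof -
  define d where "d = degree g"
  obtain n where n: "d = Suc n" using assms(1) gr0_implies_Suc unfolding d_def by blast
  define E where "E z w = (\<Sum>m\<le>d. coeff g m * of_real (norm z ^ m / norm z ^ d) *
       (\<Sum>i<m. sgn w ^ (m - Suc i) * sgn z ^ i))" for z w :: complex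
  \<comment> \<open>\<open>b E z w\<close> tends to \<open>\<i> y\<close>.\<close>
  define y where "y = real d * Im (lead_coeff g * b ^ d)"
  have lc: "lead_coeff g * b ^ d = \<i> * of_real (Im (lead_coeff g * b ^ d))"
    using crit by (simp add: complex_eq_iff d_def)
  have b0: "b \<noteq> 0" using b by auto
  have y0: "y \<noteq> 0"
  proof
    assume "y = 0"
    then have "Im (lead_coeff g * b ^ d) = 0" by (simp add: y_def n del: times_complex.sel)
    then have "lead_coeff g * b ^ d = 0" by (subst lc) simp
    then show False using b0 assms(1) by auto
  qed
  note T1 = filterlim_compose[OF tendsto_sgn_toward filterlim_fst]
  note T2 = filterlim_compose[OF tendsto_sgn_toward filterlim_snd]
  have "((\<lambda>(z, w). E z w) \<longlongrightarrow>
     (\<Sum>m\<le>d. coeff g m * of_real (if m = d then 1 else 0) * (\<Sum>i<m. b ^ (m - Suc i) * b ^ i)))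
     (toward b \<times>\<^sub>F toward b)"
    unfolding E_def case_prod_unfold
    by (intro tendsto_sum tendsto_mult tendsto_const tendsto_of_real tendsto_power T1 T2
          filterlim_compose[OF power_over_power_norm_toward filterlim_fst]) simp
  also have "(\<Sum>m\<le>d. coeff g m * of_real (if m = d then 1 else 0) * (\<Sum>i<m. b ^ (m - Suc i) * b ^ i))
      = (\<Sum>m\<le>d. if m = d then coeff g d * (\<Sum>i<d. b ^ (d - Suc i) * b ^ i) else 0)"
    by (intro sum.cong) auto
  also have "\<dots> = coeff g d * (\<Sum>i<d. b ^ (d - Suc i) * b ^ i)" by simp
  also have "(\<Sum>i<d. b ^ (d - Suc i) * b ^ i) = (\<Sum>i<d. b ^ n)"
    by (intro sum.cong refl) (auto simp: n power_add[symmetric])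
  finally have "((\<lambda>(z, w). E z w) \<longlongrightarrow> coeff g d * (of_nat d * b ^ n)) (toward b \<times>\<^sub>F toward b)"
    by simp
  then have "((\<lambda>(z, w). b * E z w) \<longlongrightarrow> b * (coeff g d * (of_nat d * b ^ n))) (toward b \<times>\<^sub>F toward b)"
    unfolding case_prod_unfold by (rule tendsto_mult_left)
  also have "b * (coeff g d * (of_nat d * b ^ n)) = of_nat d * (lead_coeff g * b ^ d)"
    by (simp add: n d_def[symmetric])
  also have "\<dots> = \<i> * of_real y" by (subst lc) (simp only: y_def of_real_mult of_real_of_nat_eq mult_ac)
  finally have EY: "((\<lambda>(z, w). b * E z w) \<longlongrightarrow> \<i> * of_real y) (toward b \<times>\<^sub>F toward b)" .
  have P: "((\<lambda>(z, w). cnj b * sgn z) \<longlongrightarrow> cnj b * b) (toward b \<times>\<^sub>F toward b)"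
      "((\<lambda>(z, w). cnj b * sgn w) \<longlongrightarrow> cnj b * b) (toward b \<times>\<^sub>F toward b)"
    unfolding case_prod_unfold by (intro tendsto_intros T1 T2)+
  have bb: "cnj b * b = 1" using complex_norm_square[of b] b by (simp add: mult.commute)
  have y10: "\<bar>y\<bar> / 10 > 0" using y0 by simp
  have ev: "eventually (\<lambda>zw. dist (case zw of (z, w) \<Rightarrow> cnj b * sgn z) (cnj b * b) < 1 / 20) (toward b \<times>\<^sub>F toward b)"
     "eventually (\<lambda>zw. dist (case zw of (z, w) \<Rightarrow> cnj b * sgn w) (cnj b * b) < 1 / 20) (toward b \<times>\<^sub>F toward b)"
    by (rule tendstoD[OF P(1)] tendstoD[OF P(2)]; simp)+
  have nz: "eventually (\<lambda>zw. norm (fst zw) \<ge> 1) (toward b \<times>\<^sub>F toward b)"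
    using eventually_compose_filterlim[OF eventually_norm_ge_toward[of 1 b] filterlim_fst] .
  from tendstoD[OF EY y10] ev nz show ?thesis
  proof eventually_elim
    case (elim zw)
    obtain z w where zw: "zw = (z, w)" by (cases zw)
    show ?case unfolding zw case_prod_conv
    proof (rule impI)
      assume nrm: "norm z = norm w"
      \<comment> \<open>Rotating \<open>b\<close> to \<open>1\<close>: the chord from \<open>q\<close> to \<open>p\<close> is almost vertical, with increments \<open>a\<close> and \<open>D\<close> of the
      real and the imaginary part.\<close>
      define p where "p = cnj b * sgn z"
      define q where "q = cnj b * sgn w"
      define Y where "Y = b * E z w"
      define D where "D = Im p - Im q"
      define a where "a = Re p - Re q"
      have z0: "z \<noteq> 0" "w \<noteq> 0" using elim(4) nrm by (auto simp: zw)
      have Yd: "norm (Y - \<i> * of_real y) < \<bar>y\<bar> / 10"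
        and pd: "norm (p - 1) < 1 / 20" and qd: "norm (q - 1) < 1 / 20"
        using elim by (simp_all add: zw Y_def p_def q_def bb dist_norm)
      have Yb: "\<bar>Re Y\<bar> \<le> \<bar>y\<bar> / 10" "\<bar>Im Y - y\<bar> \<le> \<bar>y\<bar> / 10"
        using Yd abs_Re_le_cmod[of "Y - \<i> * of_real y"] abs_Im_le_cmod[of "Y - \<i> * of_real y"] by auto
      have pb: "\<bar>Re p - 1\<bar> \<le> 1 / 20" "\<bar>Im p\<bar> \<le> 1 / 20"
        using pd abs_Re_le_cmod[of "p - 1"] abs_Im_le_cmod[of "p - 1"] by auto
      have qb: "\<bar>Re q - 1\<bar> \<le> 1 / 20" "\<bar>Im q\<bar> \<le> 1 / 20"
        using qd abs_Re_le_cmod[of "q - 1"] abs_Im_le_cmod[of "q - 1"] by auto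
      have "norm p = 1" "norm q = 1" using b z0 by (auto simp: p_def q_def norm_mult norm_sgn)
      then have "(Re p)\<^sup>2 + (Im p)\<^sup>2 = 1" "(Re q)\<^sup>2 + (Im q)\<^sup>2 = 1"
        by (metis cmod_power2 one_power2)+
      then have aD: "a * (Re p + Re q) = - (D * (Im p + Im q))"
        by (simp add: a_def D_def algebra_simps power2_eq_square)
      have "1 \<le> \<bar>Re p + Re q\<bar>" using pb qb by linarith
      then have "\<bar>a\<bar> * 1 \<le> \<bar>a\<bar> * \<bar>Re p + Re q\<bar>" by (intro mult_left_mono) auto
      also have "\<dots> = \<bar>D\<bar> * \<bar>Im p + Im q\<bar>" using aD by (metis abs_minus_cancel abs_mult)
      also have "\<bar>Im p + Im q\<bar> \<le> 1 / 10" using pb qb by linarith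
      then have "\<bar>D\<bar> * \<bar>Im p + Im q\<bar> \<le> \<bar>D\<bar> * (1 / 10)" by (intro mult_left_mono) auto
      finally have a: "\<bar>a\<bar> \<le> \<bar>D\<bar> / 10" by simp
      define X where "X = (p - q) * Y"
      have ImY: "\<bar>Im Y\<bar> \<le> 11 / 10 * \<bar>y\<bar>" "\<bar>Im Y\<bar> \<ge> 9 / 10 * \<bar>y\<bar>" using Yb by linarith+
      have X: "Re X = a * Re Y - D * Im Y" "Im X = a * Im Y + D * Re Y"
        by (simp_all add: X_def a_def D_def)
      have "\<bar>a * Im Y\<bar> \<le> \<bar>D\<bar> / 10 * (11 / 10 * \<bar>y\<bar>)" "\<bar>D * Re Y\<bar> \<le> \<bar>D\<bar> * (\<bar>y\<bar> / 10)"
           "\<bar>a * Re Y\<bar> \<le> \<bar>D\<bar> / 10 * (\<bar>y\<bar> / 10)" "\<bar>D\<bar> * (9 / 10 * \<bar>y\<bar>) \<le> \<bar>D * Im Y\<bar>"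
        unfolding abs_mult by (intro mult_mono a ImY Yb; simp)+
      then have "\<bar>Im X\<bar> \<le> 21 / 100 * (\<bar>D\<bar> * \<bar>y\<bar>)" "89 / 100 * (\<bar>D\<bar> * \<bar>y\<bar>) \<le> \<bar>Re X\<bar>"
        unfolding X by linarith+
      moreover have "0 \<le> \<bar>D\<bar> * \<bar>y\<bar>" by simp
      ultimately have IX: "\<bar>Im X\<bar> \<le> \<bar>Re X\<bar> / 4" by linarith
      have "X = (cnj b * b) * ((sgn z - sgn w) * E z w)"
        by (simp add: X_def p_def q_def Y_def algebra_simps)
      then have "poly g z - poly g w = of_real (norm z ^ d) * X"
        using poly_diff_on_circle[OF nrm z0(1), of g] by (simp add: bb E_def d_def)
      then have "Im (poly g z - poly g w) = norm z ^ d * Im X" "Re (poly g z - poly g w) = norm z ^ d * Re X"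
        by (simp_all only: Re_complex_of_real Im_complex_of_real times_complex.sel mult_zero_left diff_0_right add_0_right)
      moreover have "norm z ^ d * \<bar>Im X\<bar> \<le> norm z ^ d * (\<bar>Re X\<bar> / 4)"
        by (intro mult_left_mono IX) simp
      ultimately show "\<bar>Im (poly g z - poly g w)\<bar> \<le> \<bar>Re (poly g z - poly g w)\<bar> / 4"
        by (simp only: abs_mult power_abs abs_norm_cancel times_divide_eq_right)
    qed
  qed
qed

text \<open>The radius \<open>\<rho>\<close> is the modulus of a point \<open>w\<close> near the ray where \<open>h = (A / B) exp g\<close> is close to \<open>1\<close>. At
  another point \<open>z\<close> of the arc, \<open>h z = h w \<cdot> (A / B)(z) / (A / B)(w) \<cdot> exp (g z - g w)\<close>, where the first two
  factors are close to \<open>1\<close> and the exponent is almost real.\<close>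

lemma one_plus_rational_exp_on_arcs:
  fixes A B g :: "complex poly"
  assumes A: "A \<noteq> 0" and B: "B \<noteq> 0" and d: "degree g > 0" and b: "norm b = 1"
    and crit: "Re (lead_coeff g * b ^ degree g) = 0"
  obtains \<delta> where "\<delta> > 0" "\<And>N. \<exists>\<rho>\<ge>N. \<forall>u. norm u = 1 \<longrightarrow> dist u b < \<delta> \<longrightarrow>
     norm (1 + poly A (of_real \<rho> * u) / poly B (of_real \<rho> * u) * exp (poly g (of_real \<rho> * u))) \<ge> 1 / 2"
proof -
  define r where "r z = poly A z / poly B z" for z
  \<comment> \<open>Pairs of points near the ray with the same modulus.\<close>
  define G where "G = inf (toward b \<times>\<^sub>F toward b) (principal {(z, w). norm z = norm w})"
  have le: "G \<le> toward b \<times>\<^sub>F toward b" by (simp add: G_def)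
  have fst: "filterlim fst (toward b) G" and snd: "filterlim snd (toward b) G"
    using filterlim_mono[OF filterlim_fst order.refl le] filterlim_mono[OF filterlim_snd order.refl le]
    by auto
  have b0: "b \<noteq> 0" using b by auto
  have evG: "eventually (\<lambda>zw. norm (fst zw) = norm (snd zw)) G"
    unfolding G_def eventually_inf_principal by (intro always_eventually) auto
  have "((\<lambda>zw. sgn (fst zw) / sgn (snd zw)) \<longlongrightarrow> b / b) G"
    using fst snd b0 by (intro tendsto_divide) (auto simp: filterlim_toward_iff)
  moreover have "eventually (\<lambda>zw. sgn (fst zw) / sgn (snd zw) = fst zw / snd zw) G"
    using evG by eventually_elim (auto simp: sgn_eq)
  ultimately have "((\<lambda>zw. fst zw / snd zw) \<longlongrightarrow> b / b) G" by (rule Lim_transform_eventually)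
  then have q1: "((\<lambda>zw. fst zw / snd zw) \<longlongrightarrow> 1) G" using b0 by simp
  have "((\<lambda>zw. r (fst zw) / r (snd zw)) \<longlongrightarrow> 1) G"
    unfolding r_def using fst snd q1
    by (intro rational_ratio_tendsto_1 A B) (auto simp: filterlim_toward_iff)
  then have "eventually (\<lambda>zw. dist (r (fst zw) / r (snd zw)) 1 < 1 / 20) G" by (rule tendstoD) simp
  then have "eventually (\<lambda>(z, w). norm z = norm w \<longrightarrow> dist (r z / r w) 1 < 1 / 20) (toward b \<times>\<^sub>F toward b)"
    unfolding G_def eventually_inf_principal by (rule eventually_mono) auto
  with poly_phase_variation_small[OF d b crit]
  have "eventually (\<lambda>(z, w). norm z = norm w \<longrightarrow> dist (r z / r w) 1 < 1 / 20 \<and>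
       \<bar>Im (poly g z - poly g w)\<bar> \<le> \<bar>Re (poly g z - poly g w)\<bar> / 4) (toward b \<times>\<^sub>F toward b)"
    by eventually_elim auto
  then obtain S where S: "eventually S (toward b)" and
    SS: "\<And>z w. S z \<Longrightarrow> S w \<Longrightarrow> norm z = norm w \<Longrightarrow> dist (r z / r w) 1 < 1 / 20 \<and>
       \<bar>Im (poly g z - poly g w)\<bar> \<le> \<bar>Re (poly g z - poly g w)\<bar> / 4"
    unfolding eventually_prod_same by auto
  from S obtain \<delta> M where \<delta>: "\<delta> > 0" and M: "\<And>z. M \<le> norm z \<Longrightarrow> dist (sgn z) b < \<delta> \<Longrightarrow> S z"
    unfolding eventually_toward by blast
  obtain \<zeta> :: "real \<Rightarrow> complex" where \<zeta>: "filterlim \<zeta> (toward b) at_top"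
    "((\<lambda>t. r (\<zeta> t) * exp (poly g (\<zeta> t))) \<longlongrightarrow> 1) at_top"
    using rational_exp_poly_near_1_toward[OF A B d b crit, folded r_def] by blast
  show thesis
  proof (rule that[OF \<delta>])
    fix N :: real
    define N' where "N' = max M (max N 1)"
    have N': "N' \<ge> M" "N' \<ge> N" "N' \<ge> 1" by (auto simp: N'_def)
    have "eventually (\<lambda>t. dist (r (\<zeta> t) * exp (poly g (\<zeta> t))) 1 < 1 / 20) at_top"
      by (rule tendstoD[OF \<zeta>(2)]) simp
    moreover have "eventually (\<lambda>t. S (\<zeta> t)) at_top"
      by (rule eventually_compose_filterlim[OF S \<zeta>(1)])
    moreover have "eventually (\<lambda>t. N' \<le> norm (\<zeta> t)) at_top"
      by (rule eventually_compose_filterlim[OF eventually_norm_ge_toward \<zeta>(1)])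
    ultimately have "eventually (\<lambda>t. dist (r (\<zeta> t) * exp (poly g (\<zeta> t))) 1 < 1 / 20 \<and> S (\<zeta> t) \<and> N' \<le> norm (\<zeta> t)) at_top"
      by eventually_elim blast
    then obtain t where "dist (r (\<zeta> t) * exp (poly g (\<zeta> t))) 1 < 1 / 20 \<and> S (\<zeta> t) \<and> N' \<le> norm (\<zeta> t)"
      using eventually_happens'[OF trivial_limit_at_top_linorder] by blast
    then obtain w where w: "dist (r w * exp (poly g w)) 1 < 1 / 20" "S w" "N' \<le> norm w" by blast
    show "\<exists>\<rho>\<ge>N. \<forall>u. norm u = 1 \<longrightarrow> dist u b < \<delta> \<longrightarrow>
     norm (1 + poly A (of_real \<rho> * u) / poly B (of_real \<rho> * u) * exp (poly g (of_real \<rho> * u))) \<ge> 1 / 2"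
    proof (intro exI[of _ "norm w"] conjI allI impI)
      show "N \<le> norm w" using w N' by linarith
      fix u assume u: "norm u = 1" "dist u b < \<delta>"
      define z where "z = of_real (norm w) * u"
      have wn: "norm w > 0" using w N' by linarith
      have nz: "norm z = norm w" using u by (simp add: z_def norm_mult)
      have "sgn z = u" using wn u by (simp add: z_def sgn_of_real_mult_unit)
      then have "S z" using M[of z] nz w N' u by simp
      from SS[OF this w(2) nz] have zw: "dist (r z / r w) 1 < 1 / 20"
        "\<bar>Im (poly g z - poly g w)\<bar> \<le> \<bar>Re (poly g z - poly g w)\<bar> / 4" by auto
      define k1 where "k1 = r w * exp (poly g w)"
      define k2 where "k2 = r z / r w"
      have "k1 * k2 - 1 = (k1 - 1) * (k2 - 1) + (k1 - 1) + (k2 - 1)" by (simp add: algebra_simps)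
      also have "norm \<dots> \<le> norm (k1 - 1) * norm (k2 - 1) + norm (k1 - 1) + norm (k2 - 1)"
        by (metis (no_types) norm_mult norm_triangle_ineq norm_triangle_le add_right_mono)
      also have "\<dots> \<le> 1 / 20 * (1 / 20) + 1 / 20 + 1 / 20"
        using w(1) zw(1) unfolding k1_def[symmetric] k2_def[symmetric] dist_norm
        by (intro add_mono mult_mono) auto
      finally have "norm (k1 * k2 - 1) \<le> 1 / 5" by simp
      then have "1 / 2 \<le> norm (1 + k1 * k2 * exp (poly g z - poly g w))"
        using zw(2) by (rule norm_one_plus_exp_ge)
      also have "r w \<noteq> 0" using zw(1) by (auto simp: dist_norm)
      then have "k1 * k2 * exp (poly g z - poly g w) = r z * exp (poly g z)"
        by (simp add: k1_def k2_def exp_diff)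
      finally show "norm (1 + poly A (of_real (norm w) * u) / poly B (of_real (norm w) * u) *
          exp (poly g (of_real (norm w) * u))) \<ge> 1 / 2" by (simp add: r_def z_def)
    qed
  qed
qed

section \<open>Star-shaped curves in a prescribed set\<close>

lemma uniform_toward_compact:
  assumes "compact K" and ev: "\<And>u. u \<in> K \<Longrightarrow> eventually S (toward u)"
    and K1: "K \<subseteq> sphere 0 1"
  shows "\<exists>M. \<forall>u\<in>K. \<forall>\<rho>\<ge>M. S (of_real \<rho> * u)"
proof -
  have "\<exists>\<delta> N. \<delta> > 0 \<and> (\<forall>z. N \<le> norm z \<longrightarrow> dist (sgn z) u < \<delta> \<longrightarrow> S z)" if "u \<in> K" for u
    using ev[OF that] unfolding eventually_toward by blast
  then obtain \<delta> N where \<delta>: "\<And>u. u \<in> K \<Longrightarrow> \<delta> u > 0"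
    and N: "\<And>u z. u \<in> K \<Longrightarrow> N u \<le> norm z \<Longrightarrow> dist (sgn z) u < \<delta> u \<Longrightarrow> S z" by metis
  have "K \<subseteq> (\<Union>u\<in>K. ball u (\<delta> u))" using \<delta> by auto
  then obtain D where D: "D \<subseteq> K" "finite D" "K \<subseteq> (\<Union>u\<in>D. ball u (\<delta> u))"
    using compactE_image[OF \<open>compact K\<close>, of K "\<lambda>u. ball u (\<delta> u)"] by auto
  define M where "M = Max (insert 1 (N ` D))"
  have M: "M \<ge> 1" "\<And>u. u \<in> D \<Longrightarrow> M \<ge> N u" using D by (auto simp: M_def)
  show ?thesis
  proof (intro exI[of _ M] ballI allI impI)
    fix u \<rho> assume u: "u \<in> K" "M \<le> \<rho>"
    then obtain v where v: "v \<in> D" "dist u v < \<delta> v" using D by (auto simp: dist_commute)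
    have n: "norm u = 1" using u K1 by auto
    have "norm (of_real \<rho> * u) = \<rho>" "sgn (of_real \<rho> * u) = u"
      using M u n by (simp_all add: norm_mult sgn_of_real_mult_unit)
    then show "S (of_real \<rho> * u)" using N[of v "of_real \<rho> * u"] v D M(2)[OF v(1)] u by auto
  qed
qed

text \<open>Away from small disjoint disks around the exceptional directions in \<open>Cr\<close> any radius above some \<open>M'\<close> is
  suitable, by compactness. So the radius may be \<open>M'\<close> outside of the disks and, inside each of them, rise to
  a radius that suits all directions of the concentric disk of half the size.\<close>

lemma continuous_radius_avoiding:
  fixes S :: "complex \<Rightarrow> bool"
  assumes fin: "finite Cr" and Cr1: "Cr \<subseteq> sphere 0 1"
    and good: "\<And>u. norm u = 1 \<Longrightarrow> u \<notin> Cr \<Longrightarrow> eventually S (toward u)"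
    and crit: "\<And>b. b \<in> Cr \<Longrightarrow> \<exists>\<delta>>0. \<forall>N. \<exists>\<rho>\<ge>N. \<forall>u. norm u = 1 \<longrightarrow> dist u b < \<delta> \<longrightarrow> S (of_real \<rho> * u)"
  obtains R where "continuous_on (sphere 0 1) R" "\<And>u. norm u = 1 \<Longrightarrow> R u \<ge> N"
     "\<And>u. norm u = 1 \<Longrightarrow> S (of_real (R u) * u)"
proof -
  from crit obtain \<delta>0 where \<delta>0: "\<And>b. b \<in> Cr \<Longrightarrow> \<delta>0 b > 0" and
    cr: "\<And>b N. b \<in> Cr \<Longrightarrow> \<exists>\<rho>\<ge>N. \<forall>u. norm u = 1 \<longrightarrow> dist u b < \<delta>0 b \<longrightarrow> S (of_real \<rho> * u)"
    by metis
  \<comment> \<open>\<open>\<delta>\<close> is at most every \<open>\<delta>0 b\<close> and half of the distance between any two points of \<open>Cr\<close>; the \<open>1\<close> only keeps the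
  set nonempty.\<close>
  define X where "X = insert 1 (\<delta>0 ` Cr \<union> (\<lambda>(a, b). dist a b / 2) ` (Cr \<times> Cr - Id))"
  define \<delta> where "\<delta> = Min X"
  have finX: "finite X" using fin by (auto simp: X_def)
  have "\<forall>x\<in>X. x > 0" using \<delta>0 by (auto simp: X_def)
  then have \<delta>: "\<delta> > 0" using finX by (simp add: \<delta>_def X_def)
  have \<delta>le: "\<delta> \<le> \<delta>0 b" if "b \<in> Cr" for b
    using that finX by (auto simp: \<delta>_def X_def)
  have sep: "2 * \<delta> \<le> dist a b" if "a \<in> Cr" "b \<in> Cr" "a \<noteq> b" for a b
  proof -
    have "dist a b / 2 \<in> X" using that by (force simp: X_def)
    then have "\<delta> \<le> dist a b / 2" unfolding \<delta>_def using finX by (intro Min_le)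
    then show ?thesis by simp
  qed
  define K where "K = sphere 0 1 - (\<Union>b\<in>Cr. ball b (\<delta> / 2))"
  have "compact K" unfolding K_def by (intro compact_diff compact_sphere open_UN ballI open_ball)
  moreover have "eventually S (toward u)" if "u \<in> K" for u
    using that \<delta> by (intro good) (auto simp: K_def)
  moreover have "K \<subseteq> sphere 0 1" by (auto simp: K_def)
  ultimately obtain M where M: "\<And>u \<rho>. u \<in> K \<Longrightarrow> \<rho> \<ge> M \<Longrightarrow> S (of_real \<rho> * u)"
    using uniform_toward_compact[of K S] by blast
  define M' where "M' = max M N"
  have "\<exists>\<rho>\<ge>M'. \<forall>u. norm u = 1 \<longrightarrow> dist u b < \<delta>0 b \<longrightarrow> S (of_real \<rho> * u)" if "b \<in> Cr" for b
    using cr[OF that] .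
  then obtain \<rho> where \<rho>: "\<And>b. b \<in> Cr \<Longrightarrow> \<rho> b \<ge> M'"
    "\<And>b u. b \<in> Cr \<Longrightarrow> norm u = 1 \<Longrightarrow> dist u b < \<delta>0 b \<Longrightarrow> S (of_real (\<rho> b) * u)" by metis
  \<comment> \<open>A bump that equals \<open>1\<close> up to \<open>\<delta> / 2\<close> and vanishes from \<open>\<delta>\<close> on.\<close>
  define h where "h x = max 0 (min 1 (2 - 2 * x / \<delta>))" for x :: real
  have h01: "h x \<ge> 0" for x by (simp add: h_def)
  have h1: "h x = 1" if "x \<le> \<delta> / 2" for x
    using that \<delta> by (auto simp: h_def field_simps min_def max_def)
  have h0: "h x = 0" if "x \<ge> \<delta>" for x
  proof -
    have "2 - 2 * x / \<delta> \<le> 0" using that \<delta> by (simp add: field_simps)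
    then show ?thesis by (auto simp: h_def)
  qed
  define R where "R u = M' + (\<Sum>b\<in>Cr. (\<rho> b - M') * h (dist u b))" for u
  show thesis
  proof
    show "continuous_on (sphere 0 1) R"
      unfolding R_def h_def by (intro continuous_intros) (use \<delta> in auto)
    have RM: "R u \<ge> M'" for u
      unfolding R_def using \<rho>(1) h01 by (simp add: sum_nonneg)
    then show "R u \<ge> N" for u using RM[of u] by (simp add: M'_def)
    show "S (of_real (R u) * u)" if u: "norm u = 1" for u
    proof (cases "u \<in> K")
      case True
      then show ?thesis using M RM[of u] by (simp add: M'_def)
    next
      case False
      then obtain b where b: "b \<in> Cr" "dist u b < \<delta> / 2" using u by (auto simp: K_def dist_commute)
      have "h (dist u b') = 0" if "b' \<in> Cr" "b' \<noteq> b" for b'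
        using sep[OF that(1) b(1) that(2)] b(2) dist_triangle2[of b' b u] \<delta>
        by (intro h0) (simp add: dist_commute)
      then have "(\<Sum>b\<in>Cr. (\<rho> b - M') * h (dist u b)) = (\<Sum>b'\<in>Cr. if b' = b then \<rho> b - M' else 0)"
        using b h1[of "dist u b"] by (intro sum.cong) auto
      then have "R u = \<rho> b" using b fin by (simp add: R_def)
      then show ?thesis using \<rho>(2)[OF b(1) u] b \<delta> \<delta>le[OF b(1)] by simp
    qed
  qed
qed

text \<open>Here \<open>V\<close> consists of the points below the graph of the radius function \<open>R\<close> in polar coordinates, and \<open>W\<close>
  of those above it.\<close>

lemma star_shaped_curve_separates:
  fixes R :: "complex \<Rightarrow> real"
  assumes R: "continuous_on (sphere 0 1) R" and RN: "\<And>u. norm u = 1 \<Longrightarrow> R u \<ge> N" and N: "N > 0"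
  defines "\<Gamma> \<equiv> (\<lambda>u. of_real (R u) * u) ` sphere 0 1"
  obtains V W where "open V" "open W" "V \<inter> W = {}" "V \<inter> \<Gamma> = {}" "W \<inter> \<Gamma> = {}" "V \<union> \<Gamma> \<union> W = UNIV"
    "ball 0 N \<subseteq> V" "bounded (V \<union> \<Gamma>)" "connected \<Gamma>" "\<Gamma> \<noteq> {}"
proof -
  define V where "V = ball 0 N \<union> {z. z \<noteq> 0 \<and> norm z < R (sgn z)}"
  define W where "W = {z. z \<noteq> 0 \<and> R (sgn z) < norm z}"
  have RNs: "N \<le> R (sgn z)" if "z \<noteq> 0" for z
    using RN[of "sgn z"] that by (simp add: norm_sgn)
  have cont: "continuous_on (- {0}) (\<lambda>z::complex. R (sgn z))"
    by (rule continuous_on_compose2[OF R])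
       (auto intro!: continuous_intros simp: norm_sgn split: if_splits)
  have op: "open (- {0::complex})" by (simp add: open_Compl)
  obtain A1 where A1: "open A1" "A1 \<inter> - {0} = {z \<in> - {0}. norm z < R (sgn z)}"
    using open_Collect_less_Int[OF continuous_on_norm_id cont] by blast
  obtain A2 where A2: "open A2" "A2 \<inter> - {0} = {z \<in> - {0}. R (sgn z) < norm z}"
    using open_Collect_less_Int[OF cont continuous_on_norm_id] by blast
  have "V = ball 0 N \<union> (A1 \<inter> - {0})" "W = A2 \<inter> - {0}" unfolding A1 A2 by (auto simp: V_def W_def)
  then have VW: "open V" "open W" using A1(1) A2(1) op by (simp_all add: open_Un open_Int)
  have \<Gamma>: "z \<in> \<Gamma> \<longleftrightarrow> z \<noteq> 0 \<and> norm z = R (sgn z)" for z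
  proof
    assume "z \<in> \<Gamma>"
    then obtain u where u: "norm u = 1" "z = of_real (R u) * u" by (auto simp: \<Gamma>_def)
    have "R u > 0" using RN[OF u(1)] N by linarith
    moreover from this have "sgn z = u" using u by (simp add: sgn_of_real_mult_unit)
    ultimately show "z \<noteq> 0 \<and> norm z = R (sgn z)" using u by (auto simp: norm_mult)
  next
    assume z: "z \<noteq> 0 \<and> norm z = R (sgn z)"
    then have "z = of_real (R (sgn z)) * sgn z" by (auto simp: sgn_eq)
    then show "z \<in> \<Gamma>" unfolding \<Gamma>_def using z by (intro image_eqI) (auto simp: norm_sgn)
  qed
  have "bounded (R ` sphere 0 1)"
    by (intro compact_imp_bounded compact_continuous_image R compact_sphere)
  then obtain c where "\<forall>x\<in>R ` sphere 0 1. norm x \<le> c" unfolding bounded_iff by blast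
  then have c: "\<And>u. norm u = 1 \<Longrightarrow> norm (R u) \<le> c" by simp
  show thesis
  proof
    show "open V" "open W" by (fact VW)+
    show "V \<inter> W = {}" using RNs by (fastforce simp: V_def W_def)
    show "V \<inter> \<Gamma> = {}" using RNs by (fastforce simp: V_def \<Gamma>)
    show "W \<inter> \<Gamma> = {}" by (auto simp: W_def \<Gamma>)
    show "V \<union> \<Gamma> \<union> W = UNIV"
    proof -
      have "z \<in> V \<union> \<Gamma> \<union> W" for z
        using N by (cases "z = 0") (auto simp: V_def W_def \<Gamma> not_less)
      then show ?thesis by blast
    qed
    show "ball 0 N \<subseteq> V" by (auto simp: V_def)
    have "norm z \<le> max N c" if "z \<in> V \<union> \<Gamma>" for z
    proof (cases "z \<in> ball 0 N")
      case False
      then have "z \<noteq> 0" "norm z \<le> R (sgn z)" using that by (auto simp: V_def \<Gamma>)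
      then show ?thesis using c[of "sgn z"] by (auto simp: norm_sgn)
    qed auto
    then show "bounded (V \<union> \<Gamma>)" unfolding bounded_iff by blast
    show "connected \<Gamma>" unfolding \<Gamma>_def
      by (intro connected_continuous_image continuous_intros R connected_sphere) simp
    have "of_real (R 1) * 1 \<in> \<Gamma>" unfolding \<Gamma>_def by (rule imageI) simp
    then show "\<Gamma> \<noteq> {}" by blast
  qed
qed

section \<open>Superlevel sets that contain curves around the origin\<close>

text \<open>The chordal distance from \<open>w\<close> to infinity is \<open>2 / sqrt (1 + \<bar>w\<bar>\<^sup>2)\<close>, so the radius \<open>\<pi> / 2\<close> describes a
  hemisphere.\<close>

lemma spherical_disk_None:
  "Some w \<in> spherical_disk None (pi / 2) \<longleftrightarrow> norm w > 1"
proof -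
  let ?x = "1 / sqrt (1 + (norm w)\<^sup>2)"
  have "1 \<le> sqrt (1 + (norm w)\<^sup>2)" by simp
  then have p: "0 < sqrt (1 + (norm w)\<^sup>2)" by linarith
  then have x: "0 \<le> ?x" "?x \<le> 1"
    using \<open>1 \<le> sqrt (1 + (norm w)\<^sup>2)\<close> by (simp_all only: divide_le_eq_1_pos) simp_all
  have "Some w \<in> spherical_disk None (pi / 2) \<longleftrightarrow> arcsin ?x < pi / 4"
    by (simp add: spherical_disk_def spherical_dist_def mult.commute)
  also have "pi / 4 = arcsin (sqrt 2 / 2)"
    using arcsin_sin[of "pi / 4"] by (simp add: sin_45)
  also have "arcsin ?x < arcsin (sqrt 2 / 2) \<longleftrightarrow> ?x < sqrt 2 / 2"
    using x by (intro arcsin_less_mono) (auto simp: abs_le_iff real_le_lsqrt sqrt2_less_2 less_imp_le)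
  also have "sqrt 2 / 2 = 1 / sqrt 2" by (simp add: real_div_sqrt field_simps)
  also have "?x < 1 / sqrt 2 \<longleftrightarrow> sqrt 2 < sqrt (1 + (norm w)\<^sup>2)"
  proof -
    have "1 / x < 1 / sqrt 2 \<longleftrightarrow> sqrt 2 < x" if "x > 0" for x
      using that by (simp add: divide_simps)
    then show ?thesis using p by blast
  qed
  also have "\<dots> \<longleftrightarrow> norm w > 1"
    by (auto simp: power2_eq_square) (smt (verit, best) mult_le_one norm_ge_zero mult_less_cancel_left_pos mult_le_cancel_left1)+
  finally show ?thesis .
qed

text \<open>The curve \<open>\<Gamma>\<close> separates its inside \<open>V\<close> from its outside \<open>W\<close>.\<close>

lemma connected_inside_curve:
  assumes "connected C" "open V" "open W" "V \<inter> W = {}" "V \<union> \<Gamma> \<union> W = UNIV" "C \<inter> \<Gamma> = {}" "x \<in> C" "x \<in> V"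
  shows "C \<subseteq> V"
proof -
  have "C \<inter> W = {}"
    using connectedD[OF assms(1-3)] assms(4-) by blast
  then show ?thesis using assms by blast
qed

locale surrounded_superlevel =
  fixes f :: "complex \<Rightarrow> complex"
  assumes hol: "f holomorphic_on UNIV"
    and surround: "\<And>N. \<exists>R. continuous_on (sphere 0 1) R \<and>
          (\<forall>u. norm u = 1 \<longrightarrow> R u \<ge> N \<and> norm (f (of_real (R u) * u)) > 1)"
    and unbdd: "\<not> bounded {z. norm (f z) \<le> 1}"
begin

definition U where "U = {z. norm (f z) > 1}"

lemma cont: "continuous_on S f"
  using hol holomorphic_on_imp_continuous_on continuous_on_subset by blast

lemma open_U: "open U"
  unfolding U_def by (intro open_Collect_less continuous_intros cont)

lemma surroundE:
  obtains V \<Gamma> W where "open V" "open W" "V \<inter> W = {}" "V \<inter> \<Gamma> = {}" "W \<inter> \<Gamma> = {}" "V \<union> \<Gamma> \<union> W = UNIV"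
    "ball 0 N \<subseteq> V" "bounded (V \<union> \<Gamma>)" "connected \<Gamma>" "\<Gamma> \<noteq> {}" "\<Gamma> \<subseteq> U"
proof -
  obtain R where R: "continuous_on (sphere 0 1) R"
     "\<And>u. norm u = 1 \<Longrightarrow> R u \<ge> max N 1" "\<And>u. norm u = 1 \<Longrightarrow> norm (f (of_real (R u) * u)) > 1"
    using surround[of "max N 1"] by blast
  define \<Gamma> where "\<Gamma> = (\<lambda>u. of_real (R u) * u) ` sphere 0 1"
  have "\<Gamma> \<subseteq> U" using R(3) by (auto simp: \<Gamma>_def U_def)
  moreover have "ball (0::complex) N \<subseteq> ball 0 (max N 1)" by auto
  ultimately show thesis
    using star_shaped_curve_separates[OF R(1,2), folded \<Gamma>_def] that[of _ _ \<Gamma>]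
    by (metis (no_types, lifting) less_max_iff_disj order_trans zero_less_one)
qed

text \<open>The frontier of a component lies outside of \<open>U\<close>, so the maximum principle rules out bounded components.\<close>

lemma component_unbounded:
  assumes C: "C \<in> components U"
  shows "\<not> bounded C"
proof
  assume bd: "bounded C"
  have op: "open C" using C open_U open_components by blast
  obtain z where z: "z \<in> C" using C in_components_nonempty by fastforce
  have "norm (f z) \<le> 1"
  proof (rule maximum_modulus_frontier[of f C])
    show "f holomorphic_on interior C" using hol holomorphic_on_subset by blast
    show "continuous_on (closure C) f" by (rule cont)
    show "norm (f w) \<le> 1" if "w \<in> frontier C" for w
    proof (rule ccontr)
      assume "\<not> norm (f w) \<le> 1"
      then have "w \<in> U" by (simp add: U_def)
      moreover have "w \<in> closure C" "w \<notin> C" using that op by (auto simp: frontier_def interior_open)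
      ultimately show False
        using C closedin_component[OF C] by (metis closedin_limpt closure_def UnE mem_Collect_eq)
    qed
  qed (use bd z in auto)
  moreover have "z \<in> U" using z C in_components_subset by blast
  ultimately show False by (simp add: U_def)
qed

text \<open>Every component contains any curve that surrounds one of its points, and a large enough curve surrounds a
  point of each of two given components.\<close>

lemma connected_U: "connected U"
proof (rule ccontr)
  assume "\<not> connected U"
  then obtain z1 z2 where z12: "z1 \<in> U" "z2 \<in> U" "\<not> connected_component U z1 z2"
    unfolding connected_iff_connected_component by blast
  define C1 C2 where "C1 = connected_component_set U z1" "C2 = connected_component_set U z2"
  have C: "C1 \<in> components U" "C2 \<in> components U" using z12 by (auto simp: C1_C2_def components_def)
  have z: "z1 \<in> C1" "z2 \<in> C2" using z12 by (auto simp: C1_C2_def)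
  have "z2 \<notin> C1" using z12(3) by (simp add: C1_C2_def)
  then have "C1 \<noteq> C2" using z(2) by blast
  obtain V \<Gamma> W where S: "open V" "open W" "V \<inter> W = {}" "V \<inter> \<Gamma> = {}" "W \<inter> \<Gamma> = {}" "V \<union> \<Gamma> \<union> W = UNIV"
    "ball 0 (norm z1 + norm z2 + 1) \<subseteq> V" "bounded (V \<union> \<Gamma>)" "connected \<Gamma>" "\<Gamma> \<noteq> {}" "\<Gamma> \<subseteq> U" by (rule surroundE)
  have zV: "z1 \<in> V" "z2 \<in> V" using S(7) by (auto simp: subset_iff add_nonneg_pos)
  have meet: "C \<inter> \<Gamma> \<noteq> {}" if "C \<in> components U" "x \<in> C" "x \<in> V" for C x
    using connected_inside_curve[OF in_components_connected[OF that(1)] S(1-3,6) _ that(2,3)]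
      component_unbounded[OF that(1)] bounded_subset[OF S(8)] by blast
  have "\<Gamma> \<subseteq> C" if "C \<in> components U" "x \<in> C" "x \<in> V" for C x
    using components_maximal[OF that(1) S(9,11)] meet[OF that] by blast
  then have "C1 \<inter> C2 \<noteq> {}" using C z zV S(10) by blast
  then show False using components_nonoverlap[OF C] \<open>C1 \<noteq> C2\<close> by blast
qed

lemma bounded_if_disjoint_U:
  assumes "connected C" "C \<inter> U = {}"
  shows "bounded C"
proof (cases "C = {}")
  case False
  then obtain x where x: "x \<in> C" by blast
  obtain V \<Gamma> W where S: "open V" "open W" "V \<inter> W = {}" "V \<inter> \<Gamma> = {}" "W \<inter> \<Gamma> = {}" "V \<union> \<Gamma> \<union> W = UNIV"
    "ball 0 (norm x + 1) \<subseteq> V" "bounded (V \<union> \<Gamma>)" "connected \<Gamma>" "\<Gamma> \<noteq> {}" "\<Gamma> \<subseteq> U" by (rule surroundE)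
  have "x \<in> V" using S(7) by (auto simp: subset_iff)
  then have "C \<subseteq> V" using S assms x by (intro connected_inside_curve[of C V W \<Gamma> x]) auto
  then show ?thesis using S bounded_subset by blast
qed auto

text \<open>The inside of a curve in \<open>U\<close> is both open and closed relative to the complement of \<open>U\<close> in the sphere. So a
  component of this complement that contains a finite point stays inside a curve around this point. Finitely
  many components would cover only a bounded part of the unbounded set \<open>{z. \<bar>f z\<bar> \<le> 1}\<close>.\<close>

lemma connectivity_infinite_U: "connectivity_infinite U"
  unfolding connectivity_infinite_def
proof
  define X where "X = subtopology riemann_sphere (- (Some ` U))"
  assume "finite (connected_components_of (subtopology riemann_sphere (- Some ` U)))"
  then have fin: "finite (connected_components_of X)" by (simp add: X_def)
  have topX: "topspace X = - (Some ` U)" by (auto simp: X_def notin_range_Some)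
  have bdd: "bounded {z. Some z \<in> c}" if c: "c \<in> connected_components_of X" and "Some x \<in> c" for c x
  proof -
    obtain V \<Gamma> W where S: "open V" "open W" "V \<inter> W = {}" "V \<inter> \<Gamma> = {}" "W \<inter> \<Gamma> = {}" "V \<union> \<Gamma> \<union> W = UNIV"
      "ball 0 (norm x + 1) \<subseteq> V" "bounded (V \<union> \<Gamma>)" "connected \<Gamma>" "\<Gamma> \<noteq> {}" "\<Gamma> \<subseteq> U" by (rule surroundE)
    have x: "x \<in> V" using S(7) by (auto simp: subset_iff)
    have VW: "V \<union> \<Gamma> = - W" using S by blast
    then have "compact (V \<union> \<Gamma>)" using S by (simp add: compact_eq_bounded_closed closed_Compl)
    then have "openin riemann_sphere (insert None (Some ` (UNIV - (V \<union> \<Gamma>))))"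
      unfolding openin_Alexandroff_compactification
      by (intro disjI2 exI[of _ "V \<union> \<Gamma>"]) (auto simp: compact_imp_closed)
    then have opW: "openin riemann_sphere (insert None (Some ` W))"
      unfolding VW by (simp add: Compl_eq_Diff_UNIV[symmetric])
    have opV: "openin X (topspace X \<inter> Some ` V)" 
      unfolding X_def openin_subtopology using S by (intro exI[of _ "Some ` V"]) auto
    have compl: "topspace X - topspace X \<inter> Some ` V = insert None (Some ` W) \<inter> - (Some ` U)"
    proof -
      have "y \<notin> Some ` V \<longleftrightarrow> y \<in> insert None (Some ` W)" if "y \<notin> Some ` U" for y
      proof (cases y)
        case (Some a)
        then have "a \<notin> U" using that by blast
        then have "a \<notin> V \<longleftrightarrow> a \<in> W" using S(3,4,6,11) by blast
        then show ?thesis using Some by auto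
      qed auto
      then show ?thesis unfolding topX by blast
    qed
    have "closedin X (topspace X \<inter> Some ` V)"
      unfolding closedin_def compl using opW by (auto simp: X_def openin_subtopology)
    then have "c \<subseteq> topspace X \<inter> Some ` V \<or> disjnt c (topspace X \<inter> Some ` V)"
      using connectedin_clopen_cases[OF connectedin_connected_components_of[OF c] _ opV] by blast
    moreover have "Some x \<in> topspace X \<inter> Some ` V"
      using c \<open>Some x \<in> c\<close> x connected_components_of_subset by fastforce
    ultimately have "c \<subseteq> Some ` V" using \<open>Some x \<in> c\<close> by (auto simp: disjnt_iff)
    then have "{z. Some z \<in> c} \<subseteq> V" by auto
    then show ?thesis using S(8) bounded_subset by blast
  qed
  have bdd': "bounded {z. Some z \<in> c}" if "c \<in> connected_components_of X" for c
    using bdd[OF that] by (cases "{z. Some z \<in> c} = {}") auto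
  have "z \<in> (\<Union>c\<in>connected_components_of X. {z. Some z \<in> c})" if "norm (f z) \<le> 1" for z
  proof -
    have "Some z \<in> topspace X" using that by (auto simp: topX U_def)
    then show ?thesis unfolding Union_connected_components_of[of X, symmetric] by blast
  qed
  then have "{z. norm (f z) \<le> 1} \<subseteq> (\<Union>c\<in>connected_components_of X. {z. Some z \<in> c})" by blast
  moreover have "bounded (\<Union>c\<in>connected_components_of X. {z. Some z \<in> c})"
    using fin bdd' by (intro bounded_UN) auto
  ultimately show False using unbdd bounded_subset by blast
qed

lemma has_bov: "baker_omitted_value f None"
proof -
  have U: "{z. Some (f z) \<in> spherical_disk None (pi / 2)} = U"
    by (simp add: spherical_disk_None U_def)
  have "bounded C" if "C \<in> components (frontier U)" for C
  proof (rule bounded_if_disjoint_U)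
    show "connected C" using that in_components_connected by blast
    have "C \<subseteq> frontier U" using that in_components_subset by blast
    then show "C \<inter> U = {}" using open_U by (auto simp: frontier_def interior_open)
  qed
  moreover have "U \<noteq> {}" using surroundE by (metis subset_empty)
  ultimately show ?thesis
    unfolding baker_omitted_value_def omitted_value_def infinitely_connected_def
    using hol open_U connected_U connectivity_infinite_U
    by (intro conjI exI[of _ "pi / 2"]) (simp_all add: U pi_half_less_two[THEN less_trans] del: mem_Collect_eq)
qed

end

text \<open>Near infinity \<open>1 / f\<close> is bounded, so that it has a limit there by Riemann's theorem on removable
  singularities.\<close>

lemma entire_large_near_infinity_imp_poly:
  assumes hol: "f holomorphic_on UNIV" and bd: "bounded {z. norm (f z) \<le> 1}"
  obtains p where "\<And>z. f z = poly p z"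
proof -
  obtain B where B: "B > 0" "\<And>z. norm (f z) \<le> 1 \<Longrightarrow> norm z < B"
    using bd unfolding bounded_pos_less by auto
  \<comment> \<open>\<open>1 / f\<close> in the coordinate \<open>w = 1 / z\<close> at infinity.\<close>
  define h where "h w = inverse (f (inverse w))" for w
  have nz: "f (inverse w) \<noteq> 0 \<and> norm (f (inverse w)) > 1" if "w \<in> ball 0 (inverse B) - {0}" for w
  proof -
    have "norm w < inverse B" "norm w > 0" using that by auto
    then have "B < inverse (norm w)" using B(1) by (simp add: field_simps)
    then have "norm (inverse w) > B" by (simp add: norm_inverse)
    then have "\<not> norm (f (inverse w)) \<le> 1" using B(2) by fastforce
    then show ?thesis by auto
  qed
  have "h holomorphic_on ball 0 (inverse B) - {0}"
    unfolding h_def using nz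
    by (intro holomorphic_intros holomorphic_on_compose_gen[of inverse _ f UNIV, unfolded o_def] hol) auto
  moreover have "norm (h w) \<le> 1" if "w \<in> ball 0 (inverse B) - {0}" for w
    using nz[OF that] by (simp add: h_def norm_inverse inverse_le_1_iff)
  then have "eventually (\<lambda>w. norm (h w) \<le> 1) (at 0)"
    unfolding eventually_at using B(1) by (intro exI[of _ "inverse B"]) auto
  ultimately obtain g where g: "g holomorphic_on ball 0 (inverse B)"
     "\<And>w. w \<in> ball 0 (inverse B) - {0} \<Longrightarrow> g w = h w"
    using holomorphic_on_extend_bounded[of h "ball 0 (inverse B)" 0] B by auto
  have "g \<midarrow>0\<rightarrow> g 0"
    using g(1) B by (metis centre_in_ball continuous_on_eq_continuous_at holomorphic_on_imp_continuous_on isCont_def open_ball inverse_positive_iff_positive)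
  then have "h \<midarrow>0\<rightarrow> g 0"
    by (rule Lim_transform_within_open[of _ _ _ _ "ball 0 (inverse B)"]) (use g B in auto)
  then have "((inverse \<circ> f) \<longlongrightarrow> g 0) at_infinity"
    unfolding lim_at_infinity_0 by (simp add: h_def[abs_def] o_def)
  then obtain a n where a: "\<And>z. f z = (\<Sum>i\<le>n. a i * z ^ i)"
    using pole_at_infinity[OF hol] by blast
  have "f z = poly (\<Sum>i\<le>n. monom (a i) i) z" for z by (simp add: a poly_sum poly_monom)
  then show thesis by (rule that)
qed

section \<open>Critical directions and fundamental rays\<close>

text \<open>With \<open>c\<close> and \<open>d\<close> the leading coefficient and degree of \<open>q\<close>, the condition says that \<open>Arg c + d Arg b\<close> is
  an odd multiple of \<open>\<pi> / 2\<close>; reducing the index modulo \<open>2 d\<close> changes the angle by a multiple of \<open>2 \<pi>\<close>.\<close>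

lemma fundamental_ray_of_direction:
  fixes q :: "complex poly"
  assumes d: "degree q > 0" and b: "norm b = 1" and crit: "Re (lead_coeff q * b ^ degree q) = 0"
  shows "ray (Arg b) \<in> fundamental_rays q"
proof -
  define d where "d = degree q"
  define c where "c = lead_coeff q"
  have d0: "d > 0" and c0: "c \<noteq> 0" using d by (auto simp: d_def c_def)
  have b_eq: "b = exp (\<i> * of_real (Arg b))"
    using b Arg_eq[of b] by (metis mult_1 norm_zero of_real_1 zero_neq_one)
  have c_eq: "c = of_real (norm c) * exp (\<i> * of_real (Arg c))"
    using Arg_eq[OF c0] .
  have "c * b ^ d = of_real (norm c) * exp (\<i> * of_real (Arg c + d * Arg b))"
    by (subst c_eq, subst b_eq) (simp add: exp_of_nat_mult[symmetric] exp_add[symmetric] algebra_simps)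
  then have "Re (c * b ^ d) = norm c * cos (Arg c + d * Arg b)"
    by (simp add: Re_exp)
  then have "cos (Arg c + d * Arg b) = 0"
    using crit c0 by (simp add: c_def d_def)
  then obtain k :: int where k: "Arg c + d * Arg b = of_int k * pi + pi / 2"
    by (auto simp: cos_zero_iff_int2)
  define j where "j = nat ((k + 1) mod (2 * int d))"
  define n where "n = (k + 1) div (2 * int d)"
  have j: "j < 2 * d" "int j = (k + 1) mod (2 * int d)"
    using d0 by (auto simp: j_def nat_less_iff)
  have kj: "k + 1 = int j + 2 * int d * n" unfolding j n_def by simp
  have "real_of_int k = real j + 2 * real d * of_int n - 1"
    using arg_cong[OF kj, of real_of_int] by simp
  then have "Arg c + real d * Arg b = (real j + 2 * real d * of_int n - 1) * pi + pi / 2"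
    using k by simp
  then have "Arg b = fundamental_angle q j + 2 * pi * of_int n"
    using d0 unfolding fundamental_angle_def c_def d_def
    by (simp add: field_simps)
  then have "exp (\<i> * of_real (Arg b)) = exp (\<i> * of_real (fundamental_angle q j) + (2 * of_int n * pi) * \<i>)"
    by (simp add: algebra_simps)
  also have "\<dots> = exp (\<i> * of_real (fundamental_angle q j))"
    by (subst exp_add, subst exp_integer_2pi) simp_all
  finally have "ray (Arg b) = ray (fundamental_angle q j)" by (simp add: ray_def is_Arg_def)
  then show ?thesis unfolding fundamental_rays_def using j(1) d_def by auto
qed

text \<open>Such a number \<open>c b ^ d\<close> is \<open>\<plusminus> \<i> \<bar>c\<bar>\<close>, so that \<open>b\<close> is a root of \<open>c\<^sup>2 X ^ (2 d) + \<bar>c\<bar>\<^sup>2\<close>.\<close>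

lemma finite_critical_directions:
  fixes q :: "complex poly"
  assumes d: "degree q > 0"
  shows "finite {b. norm b = 1 \<and> Re (lead_coeff q * b ^ degree q) = 0}"
proof -
  define d c where "d = degree q" "c = lead_coeff q"
  have d0: "d > 0" and c0: "c \<noteq> 0" using d by (auto simp: d_c_def)
  define p where "p = monom (c\<^sup>2) (2 * d) + [:of_real ((norm c)\<^sup>2):]"
  have "coeff p (2 * d) = c\<^sup>2" using d0 by (simp add: p_def coeff_pCons split: nat.splits)
  then have "p \<noteq> 0" using c0 by auto
  then have "finite {b. poly p b = 0}" by (rule poly_roots_finite)
  moreover have "poly p b = 0" if "norm b = 1" "Re (c * b ^ d) = 0" for b
  proof -
    have *: "c * b ^ d = \<i> * of_real (Im (c * b ^ d))" using that(2) by (simp add: complex_eq_iff)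
    have "(norm (c * b ^ d))\<^sup>2 = (Im (c * b ^ d))\<^sup>2" using that(2) by (simp only: cmod_power2) simp
    then have "(norm c)\<^sup>2 = (Im (c * b ^ d))\<^sup>2" by (simp add: norm_mult norm_power that(1))
    moreover have "(c * b ^ d)\<^sup>2 = - of_real ((Im (c * b ^ d))\<^sup>2)"
      by (subst *) (simp add: power_mult_distrib)
    ultimately have "(c * b ^ d)\<^sup>2 = - of_real ((norm c)\<^sup>2)" by simp
    then show ?thesis by (simp add: p_def poly_monom power_mult_distrib power_mult[symmetric] mult.commute)
  qed
  ultimately show ?thesis unfolding d_c_def by (elim finite_subset[rotated]) auto
qed

section \<open>Exponential sums with exponents of distinct degrees\<close>

lemma finite_ex_arg_max:
  fixes f :: "'a \<Rightarrow> nat"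
  assumes "finite E" "E \<noteq> {}"
  obtains k where "k \<in> E" "\<And>i. i \<in> E \<Longrightarrow> f i \<le> f k"
proof -
  have "Max (f ` E) \<in> f ` E" using assms by (intro Max_in) auto
  then obtain k where "k \<in> E" "Max (f ` E) = f k" by blast
  moreover have "f i \<le> Max (f ` E)" if "i \<in> E" for i using that assms by simp
  ultimately show thesis using that by force
qed

lemma lead_coeff_diff:
  fixes p q :: "complex poly"
  assumes "degree q < degree p"
  shows "degree (p - q) = degree p" "lead_coeff (p - q) = lead_coeff p"
proof -
  show 1: "degree (p - q) = degree p"
    using degree_add_eq_left[of "- q" p] assms by simp
  show "lead_coeff (p - q) = lead_coeff p"
    unfolding 1 using assms by (simp add: coeff_eq_0)
qed

text \<open>The term with index \<open>l\<close> is the polynomial summand \<open>P l\<close>, as \<open>exp 0 = 1\<close>. Its exponent takes part in the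
  comparison of degrees with degree \<open>0\<close>.\<close>

locale exp_poly_sum =
  fixes I :: "'i set" and l :: 'i and P Q :: "'i \<Rightarrow> complex poly"
  assumes finite_I: "finite I" and l_in: "l \<in> I" and Q_l: "Q l = 0" and deg_P_l: "degree (P l) > 0"
    and P_nz: "\<And>i. i \<in> I \<Longrightarrow> P i \<noteq> 0"
    and deg_Q: "\<And>i. i \<in> I \<Longrightarrow> i \<noteq> l \<Longrightarrow> degree (Q i) > 0"
    and deg_inj: "inj_on (\<lambda>i. degree (Q i)) I"
    and nontriv: "I \<noteq> {l}"
    and crit_unique: "\<And>i j b. i \<in> I - {l} \<Longrightarrow> j \<in> I - {l} \<Longrightarrow> norm b = 1 \<Longrightarrow>
       Re (lead_coeff (Q i) * b ^ degree (Q i)) = 0 \<Longrightarrow> Re (lead_coeff (Q j) * b ^ degree (Q j)) = 0 \<Longrightarrow> i = j"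
begin

definition slope where "slope i b = Re (lead_coeff (Q i) * b ^ degree (Q i))"
definition T where "T i z = poly (P i) z * exp (poly (Q i) z)"
definition F where "F z = (\<Sum>i\<in>I. T i z)"

text \<open>The sign of the real part of \<open>Q i - Q k\<close> near the direction \<open>b\<close> is decided by the exponent of larger
  degree; here it is negative.\<close>

definition dominated where
  "dominated b i k \<longleftrightarrow> degree (Q i) < degree (Q k) \<and> slope k b > 0 \<or>
                        degree (Q k) < degree (Q i) \<and> slope i b < 0"

lemma term_ratio: "T i z / T k z = poly (P i) z / poly (P k) z * exp (poly (Q i - Q k) z)"
  by (simp add: T_def exp_diff)

lemma dominated_ratio:
  assumes "k \<in> I" "dominated b i k"
  shows "((\<lambda>z. T i z / T k z) \<longlongrightarrow> 0) (toward b)"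
proof -
  have "degree (Q i - Q k) > 0 \<and> Re (lead_coeff (Q i - Q k) * b ^ degree (Q i - Q k)) < 0"
    using assms(2) unfolding dominated_def
  proof
    assume *: "degree (Q i) < degree (Q k) \<and> slope k b > 0"
    have "Q i - Q k = - (Q k - Q i)" by simp
    then have "degree (Q i - Q k) = degree (Q k)" "lead_coeff (Q i - Q k) = - lead_coeff (Q k)"
      using lead_coeff_diff[of "Q i" "Q k"] * by (metis degree_minus, metis coeff_minus degree_minus)
    then show ?thesis using * by (simp add: slope_def)
  next
    assume *: "degree (Q k) < degree (Q i) \<and> slope i b < 0"
    then show ?thesis using lead_coeff_diff[of "Q k" "Q i"] by (simp add: slope_def)
  qed
  then show ?thesis
    unfolding term_ratio using P_nz[OF assms(1)] by (intro rational_exp_poly_tendsto_0) auto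
qed

lemma partial_sum_ratio:
  assumes J: "J \<subseteq> I" and k: "k \<in> J" and dom: "\<And>i. i \<in> J \<Longrightarrow> i \<noteq> k \<Longrightarrow> dominated b i k"
  shows "((\<lambda>z. (\<Sum>i\<in>J. T i z) / T k z) \<longlongrightarrow> 1) (toward b)"
proof -
  have kI: "k \<in> I" using J k by auto
  have Tk: "eventually (\<lambda>z. T k z \<noteq> 0) (toward b)"
    using filter_leD[OF toward_le_at_infinity eventually_poly_nonzero_at_infinity[OF P_nz[OF kI]]]
    by eventually_elim (simp add: T_def)
  have "((\<lambda>z. T i z / T k z) \<longlongrightarrow> (if i = k then 1 else 0)) (toward b)" if "i \<in> J" for i
  proof (cases "i = k")
    case True
    have "eventually (\<lambda>z. T i z / T k z = 1) (toward b)" using Tk by eventually_elim (simp add: True)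
    then show ?thesis using True by (simp add: tendsto_eventually)
  next
    case False
    then show ?thesis using dominated_ratio[OF kI dom[OF that False]] by simp
  qed
  then have "((\<lambda>z. \<Sum>i\<in>J. T i z / T k z) \<longlongrightarrow> (\<Sum>i\<in>J. if i = k then 1 else 0)) (toward b)"
    by (rule tendsto_sum)
  moreover have "(\<Sum>i\<in>J. if i = k then 1 else 0) = (1::complex)"
    using k finite_subset[OF J finite_I] by simp
  ultimately show ?thesis by (simp add: sum_divide_distrib)
qed

text \<open>This is where the polynomial summand has to be non-constant: in a direction in which all exponentials decay
  it is the dominant term.\<close>

lemma dominant_term_unbounded:
  assumes k: "k \<in> I" "k = l \<or> slope k b > 0"
  shows "filterlim (T k) at_infinity (toward b)"
proof (cases "k = l")
  case True
  have "filterlim (poly (P l)) at_infinity at_infinity"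
    by (rule filterlim_poly_at_infinity) (use deg_P_l in simp)
  then have "filterlim (poly (P l)) at_infinity (toward b)"
    by (rule filterlim_mono[OF _ order.refl toward_le_at_infinity])
  then show ?thesis by (simp add: T_def[abs_def] True Q_l)
next
  case False
  have "((\<lambda>z. poly 1 z / poly (P k) z * exp (poly (- Q k) z)) \<longlongrightarrow> 0) (toward b)"
    using k False deg_Q[of k] by (intro rational_exp_poly_tendsto_0 P_nz) (auto simp: slope_def)
  then have "((\<lambda>z. inverse (T k z)) \<longlongrightarrow> 0) (toward b)"
    by (simp add: T_def exp_minus divide_inverse)
  moreover have "eventually (\<lambda>z. T k z \<noteq> 0) (toward b)"
    using filter_leD[OF toward_le_at_infinity eventually_poly_nonzero_at_infinity[OF P_nz[OF k(1)]]]
    by eventually_elim (simp add: T_def)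
  then have "eventually (\<lambda>z. inverse (T k z) \<noteq> 0) (toward b)" by eventually_elim simp
  ultimately have "filterlim (\<lambda>z. inverse (T k z)) (at 0) (toward b)"
    by (simp add: filterlim_at)
  then show ?thesis by (simp add: filterlim_inverse_at_iff)
qed

text \<open>Among the term \<open>l\<close> and the terms that grow in the direction \<open>b\<close>, the one with the exponent of largest
  degree dominates: the other growing terms, and the term \<open>l\<close> if it is not chosen, have exponents of smaller degree, and a decaying term is beaten either by
  its own decay or by the growth of the dominant term.\<close>

lemma ex_dominant_term:
  assumes J: "J \<subseteq> I" "l \<in> J" and nz: "\<And>i. i \<in> J \<Longrightarrow> i \<noteq> l \<Longrightarrow> slope i b \<noteq> 0"
  obtains k where "k \<in> J" "k = l \<or> slope k b > 0" "\<And>i. i \<in> J \<Longrightarrow> i \<noteq> k \<Longrightarrow> dominated b i k"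
proof -
  define E where "E = insert l {i \<in> J. slope i b > 0}"
  have "finite E" "E \<noteq> {}" using finite_subset[OF J(1) finite_I] by (auto simp: E_def)
  then obtain k where k: "k \<in> E" "\<And>i. i \<in> E \<Longrightarrow> degree (Q i) \<le> degree (Q k)"
    using finite_ex_arg_max[of E "\<lambda>i. degree (Q i)"] by blast
  show thesis
  proof
    show "k \<in> J" "k = l \<or> slope k b > 0" using k J by (auto simp: E_def)
    fix i assume i: "i \<in> J" "i \<noteq> k"
    have "degree (Q i) \<noteq> degree (Q k)" using deg_inj i k J by (auto simp: E_def dest: inj_onD)
    moreover have "degree (Q i) \<le> degree (Q k)" if "\<not> slope i b < 0"
      using that nz[OF i(1)] i k(2)[of i] by (cases "i = l") (auto simp: E_def Q_l)
    moreover have "slope k b > 0" if "degree (Q i) < degree (Q k)"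
      using that k by (auto simp: E_def Q_l)
    ultimately show "dominated b i k" unfolding dominated_def by force
  qed
qed

lemma F_unbounded_if_dominant:
  assumes k: "k \<in> I" "k = l \<or> slope k b > 0" "\<And>i. i \<in> I \<Longrightarrow> i \<noteq> k \<Longrightarrow> dominated b i k"
  shows "filterlim F at_infinity (toward b)"
proof -
  have "((\<lambda>z. F z / T k z) \<longlongrightarrow> 1) (toward b)"
    unfolding F_def using k by (intro partial_sum_ratio) auto
  then have "filterlim (\<lambda>z. F z / T k z * T k z) at_infinity (toward b)"
    by (rule tendsto_mult_filterlim_at_infinity) (use dominant_term_unbounded[OF k(1,2)] in auto)
  moreover have "eventually (\<lambda>z. F z / T k z * T k z = F z) (toward b)"
    using filter_leD[OF toward_le_at_infinity eventually_poly_nonzero_at_infinity[OF P_nz[OF k(1)]]]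
    by eventually_elim (simp add: T_def)
  ultimately show ?thesis using filterlim_cong[OF refl refl] by fast
qed

lemma unbounded_imp_large:
  assumes "filterlim F at_infinity (toward b)"
  shows "eventually (\<lambda>z. norm (F z) > c) (toward b)"
  using assms unfolding filterlim_at_infinity_conv_norm_at_top filterlim_at_top_dense by blast

text \<open>Suppose that \<open>F\<close> does not tend to infinity in the direction \<open>b\<close>. Then some term \<open>j\<close> is critical there, and
  only one. Let \<open>k\<close> be dominant among the others. The degree of \<open>Q k\<close> is below that of \<open>Q j\<close>, as otherwise
  \<open>k\<close> would dominate all terms. So \<open>Q j - Q k\<close> inherits the leading term of \<open>Q j\<close>, and
  \<open>F = T k \<cdot> (1 + T j / T k + o(1))\<close> is large on suitable arcs.\<close>

lemma large_on_arcs: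
  assumes b: "norm b = 1"
  shows "\<exists>\<delta>>0. \<forall>N. \<exists>\<rho>\<ge>N. \<forall>u. norm u = 1 \<longrightarrow> dist u b < \<delta> \<longrightarrow> norm (F (of_real \<rho> * u)) > 1"
proof (cases "filterlim F at_infinity (toward b)")
  case True
  then obtain \<delta> M where \<delta>: "\<delta> > 0" and M: "\<And>z. M \<le> norm z \<Longrightarrow> dist (sgn z) b < \<delta> \<Longrightarrow> norm (F z) > 1"
    using unbounded_imp_large unfolding eventually_toward by blast
  show ?thesis
  proof (rule exI[of _ \<delta>], intro conjI allI \<delta>)
    fix N
    define \<rho> where "\<rho> = max 1 (max M N)"
    have \<rho>: "\<rho> \<ge> 1" "\<rho> \<ge> M" "\<rho> \<ge> N" by (auto simp: \<rho>_def)
    show "\<exists>\<rho>\<ge>N. \<forall>u. norm u = 1 \<longrightarrow> dist u b < \<delta> \<longrightarrow> norm (F (of_real \<rho> * u)) > 1"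
    proof (intro exI[of _ \<rho>] conjI allI impI)
      fix u :: complex assume "norm u = 1" "dist u b < \<delta>"
      then show "norm (F (of_real \<rho> * u)) > 1"
        using \<rho> by (intro M) (simp_all add: sgn_of_real_mult_unit norm_mult)
    qed (rule \<rho>(3))
  qed
next
  case False
  then obtain j where j: "j \<in> I - {l}" "slope j b = 0"
    using ex_dominant_term[of I b] l_in F_unbounded_if_dominant by (metis Diff_iff order.refl singletonD)
  have "slope i b \<noteq> 0" if "i \<in> I - {j}" "i \<noteq> l" for i
    using crit_unique[of i j b] that j b by (auto simp: slope_def)
  then obtain k where k: "k \<in> I - {j}" "k = l \<or> slope k b > 0"
    "\<And>i. i \<in> I - {j} \<Longrightarrow> i \<noteq> k \<Longrightarrow> dominated b i k"
    using ex_dominant_term[of "I - {j}" b] l_in j by blast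
  have "\<not> dominated b j k"
    using F_unbounded_if_dominant[of k b] k False by blast
  moreover have "slope k b > 0" if "degree (Q j) < degree (Q k)" using that k(2) by (auto simp: Q_l)
  moreover have "degree (Q j) \<noteq> degree (Q k)" using deg_inj j k by (auto dest: inj_onD)
  ultimately have lt: "degree (Q k) < degree (Q j)" unfolding dominated_def by linarith
  define g where "g = Q j - Q k"
  have g: "degree g = degree (Q j)" "lead_coeff g = lead_coeff (Q j)"
    unfolding g_def using lead_coeff_diff[OF lt] by auto
  have "\<exists>\<delta>>0. \<forall>N. \<exists>\<rho>\<ge>N. \<forall>u. norm u = 1 \<longrightarrow> dist u b < \<delta> \<longrightarrow>
     norm (1 + poly (P j) (of_real \<rho> * u) / poly (P k) (of_real \<rho> * u) * exp (poly g (of_real \<rho> * u))) \<ge> 1 / 2"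
    by (rule one_plus_rational_exp_on_arcs[of "P j" "P k" g b]) (use j k b g P_nz deg_Q in \<open>auto simp: slope_def\<close>)
  then obtain \<delta>1 where \<delta>1: "\<delta>1 > 0" and arc: "\<And>N. \<exists>\<rho>\<ge>N. \<forall>u. norm u = 1 \<longrightarrow> dist u b < \<delta>1 \<longrightarrow>
     norm (1 + T j (of_real \<rho> * u) / T k (of_real \<rho> * u)) \<ge> 1 / 2"
    unfolding term_ratio g_def by blast
  have "((\<lambda>z. (\<Sum>i\<in>I - {j}. T i z) / T k z) \<longlongrightarrow> 1) (toward b)"
    using k by (intro partial_sum_ratio) auto
  then have "eventually (\<lambda>z. dist ((\<Sum>i\<in>I - {j}. T i z) / T k z) 1 < 1 / 4) (toward b)"
    by (rule tendstoD) simp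
  moreover have "eventually (\<lambda>z. norm (T k z) > 4) (toward b)"
    using dominant_term_unbounded[of k b] k
    unfolding filterlim_at_infinity_conv_norm_at_top filterlim_at_top_dense by blast
  ultimately have "eventually (\<lambda>z. dist ((\<Sum>i\<in>I - {j}. T i z) / T k z) 1 < 1 / 4 \<and> norm (T k z) > 4) (toward b)"
    by eventually_elim blast
  then obtain \<delta>2 M where \<delta>2: "\<delta>2 > 0" and M: "\<And>z. M \<le> norm z \<Longrightarrow> dist (sgn z) b < \<delta>2 \<Longrightarrow>
      dist ((\<Sum>i\<in>I - {j}. T i z) / T k z) 1 < 1 / 4 \<and> norm (T k z) > 4"
    unfolding eventually_toward by blast
  show ?thesis
  proof (rule exI[of _ "min \<delta>1 \<delta>2"], intro conjI allI)
    show "min \<delta>1 \<delta>2 > 0" using \<delta>1 \<delta>2 by simp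
    fix N
    obtain \<rho> where \<rho>: "\<rho> \<ge> max 1 (max M N)" "\<And>u. norm u = 1 \<Longrightarrow> dist u b < \<delta>1 \<Longrightarrow>
       norm (1 + T j (of_real \<rho> * u) / T k (of_real \<rho> * u)) \<ge> 1 / 2" using arc by blast
    show "\<exists>\<rho>\<ge>N. \<forall>u. norm u = 1 \<longrightarrow> dist u b < min \<delta>1 \<delta>2 \<longrightarrow> norm (F (of_real \<rho> * u)) > 1"
    proof (intro exI[of _ \<rho>] conjI allI impI)
      show "\<rho> \<ge> N" using \<rho>(1) by simp
      fix u assume u: "norm (u :: complex) = 1" "dist u b < min \<delta>1 \<delta>2"
      define z where "z = of_real \<rho> * u"
      define H where "H = (\<Sum>i\<in>I - {j}. T i z) / T k z"
      have H: "norm (H - 1) < 1 / 4" and Tk: "norm (T k z) > 4"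
        using M[of z] u \<rho>(1) by (auto simp: z_def H_def dist_norm norm_mult sgn_of_real_mult_unit)
      have F: "F z = T k z * ((1 + T j z / T k z) + (H - 1))"
        using Tk sum.remove[OF finite_I, of j "\<lambda>i. T i z"] j by (auto simp: F_def H_def field_simps)
      have "norm (1 + T j z / T k z) - norm (H - 1) \<le> norm ((1 + T j z / T k z) + (H - 1))"
        by (rule norm_diff_ineq)
      then have "1 / 4 \<le> norm ((1 + T j z / T k z) + (H - 1))"
        using H \<rho>(2)[of u] u by (simp add: z_def)
      then have "4 * (1 / 4) < norm (T k z) * norm ((1 + T j z / T k z) + (H - 1))"
        using Tk by (intro mult_less_le_imp_less) auto
      then show "norm (F (of_real \<rho> * u)) > 1" unfolding z_def[symmetric] F norm_mult by simp
    qed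
  qed
qed

lemma F_surround:
  "\<exists>R. continuous_on (sphere 0 1) R \<and>
          (\<forall>u. norm u = 1 \<longrightarrow> R u \<ge> N \<and> norm (F (of_real (R u) * u)) > 1)"
proof -
  define Cr where "Cr = {b. norm b = 1 \<and> (\<exists>i\<in>I - {l}. slope i b = 0)}"
  have "Cr = (\<Union>i\<in>I - {l}. {b. norm b = 1 \<and> Re (lead_coeff (Q i) * b ^ degree (Q i)) = 0})"
    by (auto simp: Cr_def slope_def)
  then have "finite Cr" using finite_I deg_Q by (simp only:) (intro finite_UN_I finite_Diff finite_critical_directions; blast)
  moreover have "Cr \<subseteq> sphere 0 1" by (auto simp: Cr_def)
  moreover have "eventually (\<lambda>z. norm (F z) > 1) (toward u)" if "norm u = 1" "u \<notin> Cr" for u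
  proof (rule unbounded_imp_large)
    have "slope i u \<noteq> 0" if "i \<in> I" "i \<noteq> l" for i using that \<open>norm u = 1\<close> \<open>u \<notin> Cr\<close> by (auto simp: Cr_def)
    then show "filterlim F at_infinity (toward u)"
      using ex_dominant_term[of I u] l_in F_unbounded_if_dominant by (metis order.refl)
  qed
  moreover have "\<exists>\<delta>>0. \<forall>N. \<exists>\<rho>\<ge>N. \<forall>u. norm u = 1 \<longrightarrow> dist u b < \<delta> \<longrightarrow> norm (F (of_real \<rho> * u)) > 1"
    if "b \<in> Cr" for b using that by (intro large_on_arcs) (auto simp: Cr_def)
  ultimately show ?thesis
  proof (rule continuous_radius_avoiding[of Cr "\<lambda>z. norm (F z) > 1" N])
    fix R :: "complex \<Rightarrow> real"
    assume "continuous_on (sphere 0 1) R" "\<And>u. norm u = 1 \<Longrightarrow> R u \<ge> N"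
      "\<And>u. norm u = 1 \<Longrightarrow> norm (F (of_real (R u) * u)) > 1"
    then show ?thesis by (intro exI[of _ R]) simp
  qed
qed

lemma F_holomorphic: "F holomorphic_on UNIV"
  unfolding F_def T_def by (intro holomorphic_intros)

text \<open>In a direction where the leading term of the exponent of largest degree is positive, \<open>F\<close> is asymptotic to
  the corresponding term, which outgrows every polynomial.\<close>

lemma F_not_poly: "\<not> (\<forall>z. F z = poly p z)"
proof
  assume eq: "\<forall>z. F z = poly p z"
  obtain k where k: "k \<in> I" "\<And>i. i \<in> I \<Longrightarrow> degree (Q i) \<le> degree (Q k)"
    using finite_ex_arg_max[of I "\<lambda>i. degree (Q i)"] finite_I l_in by blast
  have kl: "k \<noteq> l"
  proof
    assume "k = l"
    obtain i where i: "i \<in> I" "i \<noteq> l" using nontriv l_in by auto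
    show False using k(2)[OF i(1)] deg_Q[OF i] by (simp add: \<open>k = l\<close> Q_l)
  qed
  define c d where "c = lead_coeff (Q k)" "d = degree (Q k)"
  have d0: "d > 0" and c0: "c \<noteq> 0" using deg_Q[OF k(1) kl] by (auto simp: c_d_def)
  \<comment> \<open>A direction in which \<open>c b ^ d\<close> is positive, namely \<open>\<bar>c\<bar>\<close>.\<close>
  define b where "b = exp (- (\<i> * of_real (Arg c)) / of_nat d)"
  have b1: "norm b = 1" by (simp add: b_def norm_exp_eq_Re)
  have bd: "b ^ d = exp (- (\<i> * of_real (Arg c)))"
    using d0 by (simp add: b_def exp_of_nat_mult[symmetric])
  have "c * b ^ d = (of_real (norm c) * exp (\<i> * of_real (Arg c))) * b ^ d"
    using Arg_eq[OF c0] by simp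
  also have "\<dots> = of_real (norm c)" by (simp add: bd mult.assoc exp_add[symmetric])
  finally have "c * b ^ d = of_real (norm c)" .
  then have "slope k b = norm c" unfolding slope_def c_d_def by (simp only: Re_complex_of_real)
  then have s: "slope k b > 0" using c0 by simp
  have "((\<lambda>z. F z / T k z) \<longlongrightarrow> 1) (toward b)"
    unfolding F_def
  proof (intro partial_sum_ratio k)
    fix i assume "i \<in> I" "i \<noteq> k"
    then show "dominated b i k" using k s deg_inj unfolding dominated_def by (metis inj_onD le_neq_implies_less)
  qed auto
  moreover have "((\<lambda>z. F z / T k z) \<longlongrightarrow> 0) (toward b)"
  proof -
    have "((\<lambda>z. poly p z / poly (P k) z * exp (poly (- Q k) z)) \<longlongrightarrow> 0) (toward b)"
      using s d0 by (intro rational_exp_poly_tendsto_0 P_nz k) (auto simp: slope_def c_d_def)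
    then show ?thesis by (simp add: eq T_def exp_minus divide_inverse mult.assoc)
  qed
  ultimately show False using tendsto_unique[OF toward_neq_bot[OF b1]] by fastforce
qed

end

theorem theorem1p3:
  fixes l :: nat
    and P Q :: "nat \<Rightarrow> complex poly"
  assumes "l \<ge> 2"
    and "\<And>i. i \<in> {1..l - 1} \<Longrightarrow> degree (Q i) > 0"
    and "\<And>i. i \<in> {1..l - 1} \<Longrightarrow> P i \<noteq> 0"
    and "degree (P l) > 0"
    and "\<And>i j. i \<in> {1..l - 1} \<Longrightarrow> j \<in> {1..l - 1} \<Longrightarrow> i \<noteq> j \<Longrightarrow> degree (Q i) \<noteq> degree (Q j)"
    and "\<And>i j. i \<in> {1..l - 1} \<Longrightarrow> j \<in> {1..l - 1} \<Longrightarrow> i \<noteq> j \<Longrightarrow>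
           fundamental_rays (Q i) \<inter> fundamental_rays (Q j) = {}"
  shows "baker_omitted_value
           (\<lambda>z. (\<Sum>i = 1..l - 1. poly (P i) z * exp (poly (Q i) z)) + poly (P l) z) None"
proof -
  define I where "I = {1..l}"
  define Q' where "Q' = Q(l := 0)"
  have Il: "I - {l} = {1..l - 1}" "l \<in> I" using assms(1) by (auto simp: I_def)
  have Q': "Q' i = Q i" if "i \<in> I - {l}" for i using that by (simp add: Q'_def)
  have mem: "i \<in> {1..l - 1}" if "i \<in> I - {l}" for i using that Il(1) by blast
  have deg: "0 < degree (Q' i)" if "i \<in> I" "i \<noteq> l" for i
  proof -
    have i: "i \<in> I - {l}" using that by blast
    show ?thesis unfolding Q'[OF i] by (rule assms(2)[OF mem[OF i]])
  qed
  have deg_l: "degree (Q' l) = 0" by (simp add: Q'_def)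
  interpret exp_poly_sum I l P Q'
  proof
    show "finite I" by (simp add: I_def)
    show "l \<in> I" by (fact Il(2))
    show "Q' l = 0" by (simp add: Q'_def)
    show "0 < degree (P l)" by (fact assms(4))
    show "P i \<noteq> 0" if "i \<in> I" for i
    proof (cases "i = l")
      case True
      then show ?thesis using assms(4) by (metis degree_0 less_irrefl)
    next
      case False
      then show ?thesis using mem that by (intro assms(3)) blast
    qed
    show "0 < degree (Q' i)" if "i \<in> I" "i \<noteq> l" for i using that by (rule deg)
    show "inj_on (\<lambda>i. degree (Q' i)) I"
    proof (intro inj_onI)
      fix i j assume ij: "i \<in> I" "j \<in> I" "degree (Q' i) = degree (Q' j)"
      show "i = j"
      proof (cases "i = l \<or> j = l")
        case True
        then show ?thesis using ij deg deg_l by (metis less_irrefl)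
      next
        case False
        then have m: "i \<in> I - {l}" "j \<in> I - {l}" using ij by blast+
        show ?thesis
          using ij(3) assms(5)[OF mem[OF m(1)] mem[OF m(2)]] unfolding Q'[OF m(1)] Q'[OF m(2)] by blast
      qed
    qed
    have "1 \<in> I" "1 \<noteq> l" using assms(1) by (auto simp: I_def)
    then show "I \<noteq> {l}" by blast
    show "i = j" if ij: "i \<in> I - {l}" "j \<in> I - {l}" and b: "norm b = 1"
        and crit: "Re (lead_coeff (Q' i) * b ^ degree (Q' i)) = 0"
          "Re (lead_coeff (Q' j) * b ^ degree (Q' j)) = 0" for i j b
    proof (rule ccontr)
      assume "i \<noteq> j"
      have "ray (Arg b) \<in> fundamental_rays (Q i)"
        by (rule fundamental_ray_of_direction[OF assms(2)[OF mem[OF ij(1)]] b crit(1)[unfolded Q'[OF ij(1)]]])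
      moreover have "ray (Arg b) \<in> fundamental_rays (Q j)"
        by (rule fundamental_ray_of_direction[OF assms(2)[OF mem[OF ij(2)]] b crit(2)[unfolded Q'[OF ij(2)]]])
      ultimately show False
        using assms(6)[OF mem[OF ij(1)] mem[OF ij(2)] \<open>i \<noteq> j\<close>] by blast
    qed
  qed
  interpret surrounded_superlevel F
  proof
    show "\<not> bounded {z. norm (F z) \<le> 1}"
      using entire_large_near_infinity_imp_poly[OF F_holomorphic] F_not_poly by metis
  qed (fact F_holomorphic F_surround)+
  have "F = (\<lambda>z. (\<Sum>i = 1..l - 1. poly (P i) z * exp (poly (Q i) z)) + poly (P l) z)"
  proof
    fix z
    have "F z = T l z + (\<Sum>i\<in>I - {l}. T i z)"
      unfolding F_def using finite_I l_in by (rule sum.remove)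
    also have "(\<Sum>i\<in>I - {l}. T i z) = (\<Sum>i\<in>I - {l}. poly (P i) z * exp (poly (Q i) z))"
      by (intro sum.cong) (auto simp: T_def Q')
    also have "T l z = poly (P l) z" unfolding T_def by (simp add: Q_l)
    finally show "F z = (\<Sum>i = 1..l - 1. poly (P i) z * exp (poly (Q i) z)) + poly (P l) z"
      unfolding Il(1) by (simp only: add.commute)
  qed
  then show ?thesis using has_bov by simp
qed

end
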